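(* Let $G\in\Gamma$ be a twin-free, connected bipartite graph. For each $k\in\{1,2,3,4,5,6\}$ the following are equivalent: (1) $E_k\le G\le F_k$; (2) $\|G\|=\eta_k$; (3) $\eta_{k-1}<\|G\|\le\eta_k$.
   Context: $\Gamma$ is the collection of all bipartite graphs $G\subseteq R\times C$ with $|R|,|C|\in\{1,2,\dots\}\cup\{\aleph_0\}$; the biadjacency matrix $M(G)$ has $(i,j)$ entry $1$ iff $(r_i,c_j)$ is an edge. $\|G\|$ is the Schur norm $\|M(G)\|_\bullet=\sup\{\|M(G)\bullet X\|:\|X\|\le1\}$ (entrywise product $[a_{ij}x_{ij}]$, operator norm on $\ell^2$ spaces over $\mathbb F\in\{\mathbb R,\mathbb C\}$). Two vertices are twins if they have the same neighbour sets; twin-free means no two distinct vertices are twins. $H\le G$ means $G$ has an induced subgraph $G\cap(R_0\times C_0)$ isomorphic to $H$ (isomorphisms of bipartite graphs may swap the two sides). Constants: $\eta_0=0,\ \eta_1=1,\ \eta_2=\sqrt{4/3},\ \eta_3=\frac{1+\sqrt2}2,\ \eta_4=\frac1{15}\sqrt{169+38\sqrt{19}},\ \eta_5=\sqrt{3/2},\ \eta_6=\frac25\sqrt{5+2\sqrt5}$. Graphs $E_k,F_k$ are given by biadjacency matrices: $E_1=F_1=[1]$; $E_2=\begin{bmatrix}1&1\\0&1\end{bmatrix}$, $F_2=\begin{bmatrix}1&1&0\\0&1&1\end{bmatrix}$; $E_3=\begin{bmatrix}1&1&0\\0&1&1\\0&0&1\end{bmatrix}$, $F_3=\begin{bmatrix}1&1&0&0\\1&0&1&0\\0&1&0&1\\0&0&1&1\end{bmatrix}$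 (an 8-cycle); $E_4=\begin{bmatrix}1&0&0\\1&1&1\\0&0&1\end{bmatrix}$, $F_4=\begin{bmatrix}1&0&0&1&0\\1&1&1&0&0\\0&0&1&0&1\end{bmatrix}$; $E_5=F_5=\begin{bmatrix}1&1&0&0\\1&0&1&0\\1&0&0&1\end{bmatrix}$; $E_6=\begin{bmatrix}1&1&0&0\\0&1&1&0\\0&0&1&1\\0&0&0&1\end{bmatrix}$, $F_6=\begin{bmatrix}1&1&0&0&0\\0&1&1&0&0\\0&0&1&1&0\\0&0&0&1&1\end{bmatrix}$. *)

theory Defs
  imports Complex_Main "HOL-Library.Extended_Real"
begin

text \<open>A bipartite graph G \<subseteq> R \<times> C is represented by the triple (R, C, E), where the
row vertices and the column vertices are indexed by natural numbers (so each side is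
countable, i.e. of size in {1,2,...} or aleph_0), and E \<subseteq> R \<times> C is the edge set.
The biadjacency matrix has (i,j) entry 1 iff (i,j) \<in> E.\<close>

type_synonym bgraph = "nat set \<times> nat set \<times> (nat \<times> nat) set"

definition rows :: "bgraph \<Rightarrow> nat set" where "rows G = fst G"
definition cols :: "bgraph \<Rightarrow> nat set" where "cols G = fst (snd G)"
definition edges :: "bgraph \<Rightarrow> (nat \<times> nat) set" where "edges G = snd (snd G)"

definition bigraph :: "bgraph \<Rightarrow> bool" where
  "bigraph G \<longleftrightarrow> rows G \<noteq> {} \<and> cols G \<noteq> {} \<and> edges G \<subseteq> rows G \<times> cols G"

text \<open>Twin-free: no two distinct vertices (on the same side) have the same neighbour sets.\<close>
definition twin_free :: "bgraph \<Rightarrow> bool" where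
  "twin_free G \<longleftrightarrow>
     (\<forall>r\<in>rows G. \<forall>r'\<in>rows G. (\<forall>c\<in>cols G. (r,c) \<in> edges G \<longleftrightarrow> (r',c) \<in> edges G) \<longrightarrow> r = r') \<and>
     (\<forall>c\<in>cols G. \<forall>c'\<in>cols G. (\<forall>r\<in>rows G. (r,c) \<in> edges G \<longleftrightarrow> (r,c') \<in> edges G) \<longrightarrow> c = c')"

text \<open>Connectedness of the underlying graph on the disjoint union of R and C.\<close>
definition vertices :: "bgraph \<Rightarrow> (nat + nat) set" where
  "vertices G = Inl ` rows G \<union> Inr ` cols G"

definition adj :: "bgraph \<Rightarrow> ((nat + nat) \<times> (nat + nat)) set" where
  "adj G = {(Inl r, Inr c) | r c. (r,c) \<in> edges G} \<union> {(Inr c, Inl r) | r c. (r,c) \<in> edges G}"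

definition connected_bg :: "bgraph \<Rightarrow> bool" where
  "connected_bg G \<longleftrightarrow> (\<forall>u\<in>vertices G. \<forall>v\<in>vertices G. (u,v) \<in> (adj G)\<^sup>*)"

text \<open>H \<le> G: G has an induced subgraph G \<inter> (R0 \<times> C0) isomorphic to H, where the
isomorphism may swap the two sides.\<close>
definition ind_le :: "bgraph \<Rightarrow> bgraph \<Rightarrow> bool" where
  "ind_le H G \<longleftrightarrow>
    (\<exists>f g. inj_on f (rows H) \<and> f ` rows H \<subseteq> rows G \<and>
           inj_on g (cols H) \<and> g ` cols H \<subseteq> cols G \<and>
           (\<forall>r\<in>rows H. \<forall>c\<in>cols H. (r,c) \<in> edges H \<longleftrightarrow> (f r, g c) \<in> edges G)) \<or>
    (\<exists>f g. inj_on f (rows H) \<and> f ` rows H \<subseteq> cols G \<and>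
           inj_on g (cols H) \<and> g ` cols H \<subseteq> rows G \<and>
           (\<forall>r\<in>rows H. \<forall>c\<in>cols H. (r,c) \<in> edges H \<longleftrightarrow> (g c, f r) \<in> edges G))"

text \<open>Operator norm (in [0,\<infinity>]) of a matrix A indexed by R \<times> C, as an operator
ell^2(C) \<rightarrow> ell^2(R): the supremum of |<y, A x>| over finitely supported x, y in the
closed unit balls. (Without complex conjugation on y; this gives the same supremum since
conjugation is a bijection of the unit ball.)\<close>
definition mat_norm :: "nat set \<Rightarrow> nat set \<Rightarrow> (nat \<Rightarrow> nat \<Rightarrow> 'a::real_normed_field) \<Rightarrow> ereal" where
  "mat_norm R C A =
     (SUP p \<in> {(I, J, x, y). finite I \<and> I \<subseteq> R \<and> finite J \<and> J \<subseteq> C \<and>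
                 (\<Sum>i\<in>I. (norm ((y::nat \<Rightarrow> 'a) i))\<^sup>2) \<le> 1 \<and> (\<Sum>j\<in>J. (norm ((x::nat \<Rightarrow> 'a) j))\<^sup>2) \<le> 1}.
        (case p of (I, J, x, y) \<Rightarrow> ereal (norm (\<Sum>i\<in>I. \<Sum>j\<in>J. y i * A i j * x j))))"

text \<open>Schur product of the biadjacency matrix of G with X.\<close>
definition schur_prod :: "bgraph \<Rightarrow> (nat \<Rightarrow> nat \<Rightarrow> 'a::real_normed_field) \<Rightarrow> nat \<Rightarrow> nat \<Rightarrow> 'a" where
  "schur_prod G X = (\<lambda>i j. if (i,j) \<in> edges G then X i j else 0)"

text \<open>Schur norm ||M(G)||_bullet over the scalar field 'a.\<close>
definition schur_norm_gen :: "'a::real_normed_field itself \<Rightarrow> bgraph \<Rightarrow> ereal" where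
  "schur_norm_gen _ G =
     (SUP X \<in> {X :: nat \<Rightarrow> nat \<Rightarrow> 'a. mat_norm (rows G) (cols G) X \<le> 1}.
        mat_norm (rows G) (cols G) (schur_prod G X))"

datatype scalar_field = Reals | Complexes

definition schur_norm :: "scalar_field \<Rightarrow> bgraph \<Rightarrow> ereal" where
  "schur_norm F G = (case F of Reals \<Rightarrow> schur_norm_gen TYPE(real) G
                             | Complexes \<Rightarrow> schur_norm_gen TYPE(complex) G)"

definition eta :: "nat \<Rightarrow> real" where
  "eta k = (if k = 0 then 0
     else if k = 1 then 1
     else if k = 2 then sqrt (4/3)
     else if k = 3 then (1 + sqrt 2) / 2
     else if k = 4 then sqrt (169 + 38 * sqrt 19) / 15
     else if k = 5 then sqrt (3/2)
     else if k = 6 then 2/5 * sqrt (5 + 2 * sqrt 5)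
     else undefined)"

text \<open>Graph from a 0/1 biadjacency matrix given as a list of rows.\<close>
definition mat_graph :: "nat list list \<Rightarrow> bgraph" where
  "mat_graph M = ({..<length M}, {..<length (hd M)},
                  {(i,j). i < length M \<and> j < length (hd M) \<and> M ! i ! j = 1})"

definition E_graph :: "nat \<Rightarrow> bgraph" where
  "E_graph k = mat_graph
     (if k = 1 then [[1]]
      else if k = 2 then [[1,1],[0,1]]
      else if k = 3 then [[1,1,0],[0,1,1],[0,0,1]]
      else if k = 4 then [[1,0,0],[1,1,1],[0,0,1]]
      else if k = 5 then [[1,1,0,0],[1,0,1,0],[1,0,0,1]]
      else [[1,1,0,0],[0,1,1,0],[0,0,1,1],[0,0,0,1]])"

definition F_graph :: "nat \<Rightarrow> bgraph" where
  "F_graph k = mat_graph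
     (if k = 1 then [[1]]
      else if k = 2 then [[1,1,0],[0,1,1]]
      else if k = 3 then [[1,1,0,0],[1,0,1,0],[0,1,0,1],[0,0,1,1]]
      else if k = 4 then [[1,0,0,1,0],[1,1,1,0,0],[0,0,1,0,1]]
      else if k = 5 then [[1,1,0,0],[1,0,1,0],[1,0,0,1]]
      else [[1,1,0,0,0],[0,1,1,0,0],[0,0,1,1,0],[0,0,0,1,1]])"

end

theory Submission
  imports Defs "HOL-Analysis.L2_Norm" "HOL-Analysis.Inner_Product"
begin

text \<open>
  The Schur norm is monotone under induced subgraphs, so a graph between \<open>E_k\<close> and \<open>F_k\<close> has norm
  \<open>eta k\<close> once \<open>eta k \<le> \<parallel>E_k\<parallel>\<close> and \<open>\<parallel>F_k\<parallel> \<le> eta k\<close>. The upper bound comes from a factorisation of the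
  biadjacency matrix into a Gram-type product of vectors, the lower bound from an explicit
  contraction together with two unit vectors; in both cases the data lie in a quadratic number field.

  Conversely, ten small twin-free graphs have norm greater than \<open>eta 6\<close>, as rational contractions show.
  A connected twin-free graph containing none of them is very restricted. A 4-cycle, together with
  vertices separating the opposite pairs, produces one of the two forbidden 3 by 3 graphs. The
  6-cycle is forbidden, so non-backtracking walks of length 3 and 5 have non-adjacent ends, and every
  local tree is automatically induced. Since at most one neighbour of a vertex can be a leaf, the
  forbidden trees bound all degrees by 3 and make a graph with a vertex of degree 3 one of four
  spiders. If all degrees are at most 2, a longest induced path exhausts the graph or misses one
  vertex that closes it to a cycle, and the forbidden path and cycle on 10 vertices leave only
  seven paths and the 8-cycle.
\<close>

section \<open>Schur norm bounds\<close>

lemma mat_norm_le_iff: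
  fixes A :: "nat \<Rightarrow> nat \<Rightarrow> 'a::real_normed_field"
  shows "mat_norm R C A \<le> ereal c \<longleftrightarrow>
    (\<forall>I J x y. finite I \<longrightarrow> I \<subseteq> R \<longrightarrow> finite J \<longrightarrow> J \<subseteq> C \<longrightarrow>
      (\<Sum>i\<in>I. (norm (y i))\<^sup>2) \<le> 1 \<longrightarrow> (\<Sum>j\<in>J. (norm (x j))\<^sup>2) \<le> 1 \<longrightarrow>
      norm (\<Sum>i\<in>I. \<Sum>j\<in>J. y i * A i j * x j) \<le> c)"
  unfolding mat_norm_def SUP_le_iff by auto

lemma mat_norm_leD:
  fixes A :: "nat \<Rightarrow> nat \<Rightarrow> 'a::real_normed_field"
  assumes "mat_norm R C A \<le> 1" "finite I" "I \<subseteq> R" "finite J" "J \<subseteq> C"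
    and "(\<Sum>i\<in>I. (norm (y i))\<^sup>2) \<le> 1" "(\<Sum>j\<in>J. (norm (x j))\<^sup>2) \<le> 1"
  shows "norm (\<Sum>i\<in>I. \<Sum>j\<in>J. y i * A i j * x j) \<le> 1"
  using assms(1)[unfolded one_ereal_def mat_norm_le_iff, rule_format, OF assms(2-)] .

lemma mat_norm_ge:
  fixes A :: "nat \<Rightarrow> nat \<Rightarrow> 'a::real_normed_field"
  assumes "finite I" "I \<subseteq> R" "finite J" "J \<subseteq> C"
    and "(\<Sum>i\<in>I. (norm (y i))\<^sup>2) \<le> 1" "(\<Sum>j\<in>J. (norm (x j))\<^sup>2) \<le> 1"
  shows "ereal (norm (\<Sum>i\<in>I. \<Sum>j\<in>J. y i * A i j * x j)) \<le> mat_norm R C A"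
  unfolding mat_norm_def
  by (rule SUP_upper2[where i = "(I, J, x, y)"]) (use assms in auto)

lemma contraction_bilinear_bound:
  fixes X :: "nat \<Rightarrow> nat \<Rightarrow> 'a::real_normed_field"
  assumes X: "mat_norm R C X \<le> 1" and fin: "finite I" "I \<subseteq> R" "finite J" "J \<subseteq> C"
  shows "norm (\<Sum>i\<in>I. \<Sum>j\<in>J. y i * X i j * x j)
    \<le> L2_set (\<lambda>i. norm (y i)) I * L2_set (\<lambda>j. norm (x j)) J"
proof -
  define s t where "s = L2_set (\<lambda>i. norm (y i)) I" and "t = L2_set (\<lambda>j. norm (x j)) J"
  have s0: "s \<ge> 0" and t0: "t \<ge> 0" by (simp_all add: s_def t_def)
  show ?thesis
  proof (cases "s = 0 \<or> t = 0")
    case True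
    then have "(\<forall>i\<in>I. y i = 0) \<or> (\<forall>j\<in>J. x j = 0)"
      using fin by (auto simp: s_def t_def L2_set_eq_0_iff)
    then have "(\<Sum>i\<in>I. \<Sum>j\<in>J. y i * X i j * x j) = 0"
      by (auto intro!: sum.neutral)
    then show ?thesis by simp
  next
    case False
    then have pos: "s > 0" "t > 0" using s0 t0 by auto
    have s2: "s\<^sup>2 = (\<Sum>i\<in>I. (norm (y i))\<^sup>2)" and t2: "t\<^sup>2 = (\<Sum>j\<in>J. (norm (x j))\<^sup>2)"
      by (simp_all add: s_def t_def L2_set_def sum_nonneg)
    define y' x' where "y' i = y i / of_real s" and "x' j = x j / of_real t" for i j
    have "(\<Sum>i\<in>I. (norm (y' i))\<^sup>2) = s\<^sup>2 / s\<^sup>2"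
      unfolding s2 sum_divide_distrib
      by (rule sum.cong) (use pos s2 in \<open>simp_all add: y'_def norm_divide power_divide\<close>)
    then have y': "(\<Sum>i\<in>I. (norm (y' i))\<^sup>2) \<le> 1" using pos by simp
    have "(\<Sum>j\<in>J. (norm (x' j))\<^sup>2) = t\<^sup>2 / t\<^sup>2"
      unfolding t2 sum_divide_distrib
      by (rule sum.cong) (use pos t2 in \<open>simp_all add: x'_def norm_divide power_divide\<close>)
    then have x': "(\<Sum>j\<in>J. (norm (x' j))\<^sup>2) \<le> 1" using pos by simp
    have "norm (\<Sum>i\<in>I. \<Sum>j\<in>J. y' i * X i j * x' j) \<le> 1"
      using mat_norm_leD[OF X fin y' x'] .
    moreover have "(\<Sum>i\<in>I. \<Sum>j\<in>J. y i * X i j * x j)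
        = of_real (s * t) * (\<Sum>i\<in>I. \<Sum>j\<in>J. y' i * X i j * x' j)"
      unfolding sum_distrib_left
      by (intro sum.cong refl) (use pos in \<open>simp add: y'_def x'_def\<close>)
    ultimately have "norm (\<Sum>i\<in>I. \<Sum>j\<in>J. y i * X i j * x j) \<le> s * t"
      using pos by (simp add: norm_mult)
    then show ?thesis by (simp add: s_def t_def)
  qed
qed

text \<open>The easy half of Haagerup's characterisation of Schur multipliers: a weighted Gram
  factorisation of the symbol bounds its Schur norm.\<close>

lemma schur_norm_gen_le:
  fixes w :: "nat \<Rightarrow> real" and a b :: "nat \<Rightarrow> nat \<Rightarrow> real"
  assumes w: "\<And>k. k \<in> K \<Longrightarrow> w k \<ge> 0" and K: "finite K" and h: "h \<ge> 0"
    and fac: "\<And>i j. i \<in> rows G \<Longrightarrow> j \<in> cols G \<Longrightarrow>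
      (\<Sum>k\<in>K. w k * a i k * b j k) = (if (i, j) \<in> edges G then 1 else 0)"
    and a: "\<And>i. i \<in> rows G \<Longrightarrow> (\<Sum>k\<in>K. w k * (a i k)\<^sup>2) \<le> 1"
    and b: "\<And>j. j \<in> cols G \<Longrightarrow> (\<Sum>k\<in>K. w k * (b j k)\<^sup>2) \<le> h\<^sup>2"
  shows "schur_norm_gen TYPE('a::real_normed_field) G \<le> ereal h"
  unfolding schur_norm_gen_def
proof (rule SUP_least, unfold mat_norm_le_iff, intro allI impI)
  fix X :: "nat \<Rightarrow> nat \<Rightarrow> 'a" and I J :: "nat set" and x y :: "nat \<Rightarrow> 'a"
  assume "X \<in> {X. mat_norm (rows G) (cols G) X \<le> 1}"
  then have X: "mat_norm (rows G) (cols G) X \<le> 1" by simp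
  assume fin: "finite I" "I \<subseteq> rows G" "finite J" "J \<subseteq> cols G"
    and y: "(\<Sum>i\<in>I. (norm (y i))\<^sup>2) \<le> 1" and x: "(\<Sum>j\<in>J. (norm (x j))\<^sup>2) \<le> 1"
  define ya xb where "ya k i = of_real (a i k) * y i" and "xb k j = of_real (b j k) * x j" for k i j
  define p q where "p k = L2_set (\<lambda>i. norm (ya k i)) I" and "q k = L2_set (\<lambda>j. norm (xb k j)) J" for k
  \<comment> \<open>Inserting the factorisation of the symbol turns the form of the Schur product
    into a weighted sum over \<open>k\<close> of forms of \<open>X\<close> itself, evaluated at the
    vectors \<open>ya k\<close> and \<open>xb k\<close>.\<close>
  have "(\<Sum>i\<in>I. \<Sum>j\<in>J. y i * schur_prod G X i j * x j)
      = (\<Sum>i\<in>I. \<Sum>j\<in>J. \<Sum>k\<in>K. of_real (w k) * (ya k i * X i j * xb k j))"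
  proof (intro sum.cong refl)
    fix i j assume ij: "i \<in> I" "j \<in> J"
    have "y i * schur_prod G X i j * x j = of_real (if (i, j) \<in> edges G then 1 else 0) * (y i * X i j * x j)"
      by (simp add: schur_prod_def)
    also have "\<dots> = of_real (\<Sum>k\<in>K. w k * a i k * b j k) * (y i * X i j * x j)"
      by (subst fac) (use ij fin in auto)
    also have "\<dots> = (\<Sum>k\<in>K. of_real (w k) * (ya k i * X i j * xb k j))"
      unfolding of_real_sum sum_distrib_right by (intro sum.cong refl) (simp add: ya_def xb_def)
    finally show "y i * schur_prod G X i j * x j = (\<Sum>k\<in>K. of_real (w k) * (ya k i * X i j * xb k j))" .
  qed
  also have "\<dots> = (\<Sum>i\<in>I. \<Sum>k\<in>K. \<Sum>j\<in>J. of_real (w k) * (ya k i * X i j * xb k j))"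
    by (rule sum.cong[OF refl], rule sum.swap)
  also have "\<dots> = (\<Sum>k\<in>K. of_real (w k) * (\<Sum>i\<in>I. \<Sum>j\<in>J. ya k i * X i j * xb k j))"
    unfolding sum_distrib_left by (rule sum.swap)
  finally have "norm (\<Sum>i\<in>I. \<Sum>j\<in>J. y i * schur_prod G X i j * x j)
      \<le> (\<Sum>k\<in>K. norm (of_real (w k) * (\<Sum>i\<in>I. \<Sum>j\<in>J. ya k i * X i j * xb k j)))"
    by (simp only: norm_sum)
  \<comment> \<open>Each weight is shared equally between the two factors, in preparation for the
    Cauchy-Schwarz inequality over \<open>k\<close>.\<close>
  also have "\<dots> \<le> (\<Sum>k\<in>K. \<bar>sqrt (w k) * p k\<bar> * \<bar>sqrt (w k) * q k\<bar>)"
  proof (rule sum_mono)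
    fix k assume k: "k \<in> K"
    have "norm (of_real (w k) * (\<Sum>i\<in>I. \<Sum>j\<in>J. ya k i * X i j * xb k j)) \<le> w k * (p k * q k)"
      using contraction_bilinear_bound[OF X fin, of "ya k" "xb k"] w[OF k]
      by (auto simp: norm_mult p_def q_def intro: mult_left_mono)
    also have "\<dots> = (sqrt (w k) * p k) * (sqrt (w k) * q k)"
      using w[OF k] by simp
    also have "\<dots> \<le> \<bar>sqrt (w k) * p k\<bar> * \<bar>sqrt (w k) * q k\<bar>"
      by (metis abs_ge_self abs_mult)
    finally show "norm (of_real (w k) * (\<Sum>i\<in>I. \<Sum>j\<in>J. ya k i * X i j * xb k j))
      \<le> \<bar>sqrt (w k) * p k\<bar> * \<bar>sqrt (w k) * q k\<bar>" .
  qed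
  also have "\<dots> \<le> L2_set (\<lambda>k. sqrt (w k) * p k) K * L2_set (\<lambda>k. sqrt (w k) * q k) K"
    by (rule L2_set_mult_ineq)
  \<comment> \<open>Exchanging the sums over \<open>k\<close> and over the indices reassembles the
    weighted squared lengths of the Gram vectors, which \<open>a\<close> and \<open>b\<close> bound
    by 1 and by the square of \<open>h\<close>.\<close>
  also have "\<dots> \<le> 1 * h"
  proof (rule mult_mono)
    have "(\<Sum>k\<in>K. (sqrt (w k) * p k)\<^sup>2) = (\<Sum>k\<in>K. \<Sum>i\<in>I. w k * (a i k)\<^sup>2 * (norm (y i))\<^sup>2)"
      by (intro sum.cong refl) (use w in \<open>auto simp: p_def L2_set_def power_mult_distrib sum_nonneg
            sum_distrib_left ya_def norm_mult mult.assoc intro!: sum.cong\<close>)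
    also have "\<dots> = (\<Sum>i\<in>I. (\<Sum>k\<in>K. w k * (a i k)\<^sup>2) * (norm (y i))\<^sup>2)"
      by (subst sum.swap) (simp add: sum_distrib_right)
    also have "\<dots> \<le> (\<Sum>i\<in>I. 1 * (norm (y i))\<^sup>2)"
      by (intro sum_mono mult_right_mono a) (use fin in auto)
    finally show "L2_set (\<lambda>k. sqrt (w k) * p k) K \<le> 1"
      using y by (simp add: L2_set_def)
    have "(\<Sum>k\<in>K. (sqrt (w k) * q k)\<^sup>2) = (\<Sum>k\<in>K. \<Sum>j\<in>J. w k * (b j k)\<^sup>2 * (norm (x j))\<^sup>2)"
      by (intro sum.cong refl) (use w in \<open>auto simp: q_def L2_set_def power_mult_distrib sum_nonneg
            sum_distrib_left xb_def norm_mult mult.assoc intro!: sum.cong\<close>)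
    also have "\<dots> = (\<Sum>j\<in>J. (\<Sum>k\<in>K. w k * (b j k)\<^sup>2) * (norm (x j))\<^sup>2)"
      by (subst sum.swap) (simp add: sum_distrib_right)
    also have "\<dots> \<le> (\<Sum>j\<in>J. h\<^sup>2 * (norm (x j))\<^sup>2)"
      by (intro sum_mono mult_right_mono b) (use fin in auto)
    also have "\<dots> \<le> h\<^sup>2 * 1"
      unfolding sum_distrib_left[symmetric] by (rule mult_left_mono[OF x]) simp
    finally show "L2_set (\<lambda>k. sqrt (w k) * q k) K \<le> h"
      using h by (simp add: L2_set_def real_le_lsqrt sum_nonneg)
  qed simp_all
  finally show "norm (\<Sum>i\<in>I. \<Sum>j\<in>J. y i * schur_prod G X i j * x j) \<le> h" by simp
qed

text \<open>A Schur test: the squared length of the transposed matrix applied to \<open>v\<close> is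
  the quadratic form of the Gram matrix of the rows, and a symmetric matrix is bounded by its
  largest absolute row sum. The sort \<open>real_inner\<close> covers real and complex scalars at
  once.\<close>

lemma real_matrix_contraction:
  fixes x :: "nat \<Rightarrow> nat \<Rightarrow> real"
  assumes R: "finite R" and C: "finite C"
    and gram: "\<And>i. i \<in> R \<Longrightarrow> (\<Sum>k\<in>R. \<bar>\<Sum>j\<in>C. x i j * x k j\<bar>) \<le> 1"
  shows "mat_norm R C (\<lambda>i j. of_real (x i j) :: 'a::{real_normed_field,real_inner}) \<le> 1"
  unfolding one_ereal_def mat_norm_le_iff
proof (intro allI impI)
  fix I J :: "nat set" and u v :: "nat \<Rightarrow> 'a"
  assume I: "finite I" "I \<subseteq> R" and J: "finite J" "J \<subseteq> C"
    and v: "(\<Sum>i\<in>I. (norm (v i))\<^sup>2) \<le> 1" and u: "(\<Sum>j\<in>J. (norm (u j))\<^sup>2) \<le> 1"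
  define z where "z j = (\<Sum>i\<in>I. x i j *\<^sub>R v i)" for j
  have "norm (\<Sum>i\<in>I. \<Sum>j\<in>J. v i * of_real (x i j) * u j) = norm (\<Sum>j\<in>J. z j * u j)"
    by (subst sum.swap) (simp add: z_def sum_distrib_left scaleR_conv_of_real mult_ac)
  also have "\<dots> \<le> (\<Sum>j\<in>J. \<bar>norm (z j)\<bar> * \<bar>norm (u j)\<bar>)"
    by (rule order_trans[OF norm_sum]) (simp add: norm_mult)
  also have "\<dots> \<le> L2_set (\<lambda>j. norm (z j)) J * L2_set (\<lambda>j. norm (u j)) J"
    by (rule L2_set_mult_ineq)
  also have "\<dots> \<le> 1 * 1"
  proof (rule mult_mono)
    have "(\<Sum>j\<in>J. (norm (z j))\<^sup>2) \<le> (\<Sum>j\<in>C. (norm (z j))\<^sup>2)"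
      by (rule sum_mono2) (use C J in auto)
    also have "\<dots> = (\<Sum>j\<in>C. \<Sum>i\<in>I. \<Sum>k\<in>I. x i j * x k j * inner (v i) (v k))"
      by (simp add: power2_norm_eq_inner z_def inner_sum_left inner_sum_right sum_distrib_left mult_ac
          inner_commute)
    also have "\<dots> = (\<Sum>i\<in>I. \<Sum>k\<in>I. (\<Sum>j\<in>C. x i j * x k j) * inner (v i) (v k))"
      by (subst sum.swap, rule sum.cong, rule refl, subst sum.swap) (simp add: sum_distrib_right)
    \<comment> \<open>Cauchy-Schwarz for the two scalars, followed by the arithmetic-geometric mean
      inequality.\<close>
    also have "\<dots> \<le> (\<Sum>i\<in>I. \<Sum>k\<in>I. \<bar>\<Sum>j\<in>C. x i j * x k j\<bar> * (((norm (v i))\<^sup>2 + (norm (v k))\<^sup>2) / 2))"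
    proof (intro sum_mono)
      fix i k
      have "(norm (v i) - norm (v k))\<^sup>2 \<ge> 0" by simp
      then have "norm (v i) * norm (v k) \<le> ((norm (v i))\<^sup>2 + (norm (v k))\<^sup>2) / 2"
        by (simp add: power2_diff)
      then have "\<bar>inner (v i) (v k)\<bar> \<le> ((norm (v i))\<^sup>2 + (norm (v k))\<^sup>2) / 2"
        using Cauchy_Schwarz_ineq2[of "v i" "v k"] by linarith
      then have "\<bar>\<Sum>j\<in>C. x i j * x k j\<bar> * \<bar>inner (v i) (v k)\<bar>
          \<le> \<bar>\<Sum>j\<in>C. x i j * x k j\<bar> * (((norm (v i))\<^sup>2 + (norm (v k))\<^sup>2) / 2)"
        by (rule mult_left_mono) simp
      then show "(\<Sum>j\<in>C. x i j * x k j) * inner (v i) (v k)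
          \<le> \<bar>\<Sum>j\<in>C. x i j * x k j\<bar> * (((norm (v i))\<^sup>2 + (norm (v k))\<^sup>2) / 2)"
        unfolding abs_mult[symmetric] by linarith
    qed
    \<comment> \<open>The Gram matrix is symmetric, so both halves of the mean contribute the same
      double sum.\<close>
    also have "\<dots> = (\<Sum>i\<in>I. \<Sum>k\<in>I. \<bar>\<Sum>j\<in>C. x i j * x k j\<bar> * (norm (v i))\<^sup>2)"
    proof -
      let ?g = "\<lambda>i k. \<bar>\<Sum>j\<in>C. x i j * x k j\<bar>"
      have "(\<Sum>i\<in>I. \<Sum>k\<in>I. ?g i k * (norm (v k))\<^sup>2) = (\<Sum>i\<in>I. \<Sum>k\<in>I. ?g i k * (norm (v i))\<^sup>2)"
        by (subst sum.swap) (simp add: mult.commute)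
      then show ?thesis
        by (simp add: add_divide_distrib distrib_left sum.distrib sum_divide_distrib[symmetric])
    qed
    also have "\<dots> \<le> (\<Sum>i\<in>I. 1 * (norm (v i))\<^sup>2)"
    proof (intro sum_mono)
      fix i assume i: "i \<in> I"
      have "(\<Sum>k\<in>I. \<bar>\<Sum>j\<in>C. x i j * x k j\<bar>) \<le> (\<Sum>k\<in>R. \<bar>\<Sum>j\<in>C. x i j * x k j\<bar>)"
        by (rule sum_mono2) (use R I in auto)
      also have "\<dots> \<le> 1" using gram i I by auto
      finally show "(\<Sum>k\<in>I. \<bar>\<Sum>j\<in>C. x i j * x k j\<bar> * (norm (v i))\<^sup>2) \<le> 1 * (norm (v i))\<^sup>2"
        unfolding sum_distrib_right[symmetric] by (rule mult_right_mono) simp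
    qed
    finally show "L2_set (\<lambda>j. norm (z j)) J \<le> 1" using v by (simp add: L2_set_def)
    show "L2_set (\<lambda>j. norm (u j)) J \<le> 1" using u by (simp add: L2_set_def)
  qed simp_all
  finally show "norm (\<Sum>i\<in>I. \<Sum>j\<in>J. v i * of_real (x i j) * u j) \<le> 1" by simp
qed

text \<open>Real data are carried into \<open>'a\<close> by \<open>of_real\<close>, so a single
  certificate serves both scalar fields.\<close>

lemma schur_norm_gen_ge:
  fixes x :: "nat \<Rightarrow> nat \<Rightarrow> real" and u v :: "nat \<Rightarrow> real"
  assumes fin: "finite (rows G)" "finite (cols G)"
    and gram: "\<And>i. i \<in> rows G \<Longrightarrow> (\<Sum>k\<in>rows G. \<bar>\<Sum>j\<in>cols G. x i j * x k j\<bar>) \<le> 1"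
    and v: "(\<Sum>i\<in>rows G. (v i)\<^sup>2) \<le> 1" and u: "(\<Sum>j\<in>cols G. (u j)\<^sup>2) \<le> 1"
  shows "ereal (\<Sum>i\<in>rows G. \<Sum>j\<in>cols G. if (i, j) \<in> edges G then v i * x i j * u j else 0)
    \<le> schur_norm_gen TYPE('a::{real_normed_field,real_inner}) G"
proof -
  let ?X = "\<lambda>i j. of_real (x i j) :: 'a"
  have eq: "(\<Sum>i\<in>rows G. \<Sum>j\<in>cols G. of_real (v i) * schur_prod G ?X i j * of_real (u j))
      = (of_real (\<Sum>i\<in>rows G. \<Sum>j\<in>cols G. if (i, j) \<in> edges G then v i * x i j * u j else 0) :: 'a)"
    unfolding of_real_sum by (intro sum.cong refl) (simp add: schur_prod_def)
  have "ereal (\<Sum>i\<in>rows G. \<Sum>j\<in>cols G. if (i, j) \<in> edges G then v i * x i j * u j else 0)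
      \<le> ereal (norm (\<Sum>i\<in>rows G. \<Sum>j\<in>cols G. of_real (v i) * schur_prod G ?X i j * of_real (u j)))"
    unfolding eq norm_of_real ereal_less_eq by (rule abs_ge_self)
  also have "\<dots> \<le> mat_norm (rows G) (cols G) (schur_prod G ?X)"
    by (rule mat_norm_ge) (use fin u v in auto)
  also have "\<dots> \<le> schur_norm_gen TYPE('a) G"
    unfolding schur_norm_gen_def
    by (rule SUP_upper) (use real_matrix_contraction[OF fin gram] in simp)
  finally show ?thesis .
qed

section \<open>Transposition and monotonicity under induced subgraphs\<close>

definition transpose_bg :: "bgraph \<Rightarrow> bgraph" where
  "transpose_bg G = (cols G, rows G, (edges G)\<inverse>)"

lemma transpose_bg_simps [simp]:
  "rows (transpose_bg G) = cols G" "cols (transpose_bg G) = rows G"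
  "(i, j) \<in> edges (transpose_bg G) \<longleftrightarrow> (j, i) \<in> edges G"
  by (simp_all add: transpose_bg_def rows_def cols_def edges_def)

text \<open>The form in \<open>mat_norm\<close> is bilinear, without conjugation, so transposing
  amounts to exchanging the two test vectors.\<close>

lemma mat_norm_transpose_le:
  fixes A :: "nat \<Rightarrow> nat \<Rightarrow> 'a::real_normed_field"
  shows "mat_norm C R (\<lambda>j i. A i j) \<le> mat_norm R C A"
  unfolding mat_norm_def[of C R]
proof (rule SUP_least, clarsimp)
  fix J I and y x :: "nat \<Rightarrow> 'a"
  assume "finite J" "J \<subseteq> C" "finite I" "I \<subseteq> R"
    and "(\<Sum>i\<in>J. (norm (x i))\<^sup>2) \<le> 1" and "(\<Sum>j\<in>I. (norm (y j))\<^sup>2) \<le> 1"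
  then have "ereal (norm (\<Sum>i\<in>I. \<Sum>j\<in>J. y i * A i j * x j)) \<le> mat_norm R C A"
    by (intro mat_norm_ge)
  also have "(\<Sum>i\<in>I. \<Sum>j\<in>J. y i * A i j * x j) = (\<Sum>j\<in>J. \<Sum>i\<in>I. x j * A i j * y i)"
    by (subst sum.swap) (simp add: mult_ac)
  finally show "ereal (norm (\<Sum>j\<in>J. \<Sum>i\<in>I. x j * A i j * y i)) \<le> mat_norm R C A" .
qed

lemma mat_norm_transpose:
  fixes A :: "nat \<Rightarrow> nat \<Rightarrow> 'a::real_normed_field"
  shows "mat_norm C R (\<lambda>j i. A i j) = mat_norm R C A"
  using mat_norm_transpose_le[of C R A] mat_norm_transpose_le[of R C "\<lambda>j i. A i j"]
  by (intro antisym) auto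

lemma schur_norm_gen_transpose_le:
  "schur_norm_gen TYPE('a::real_normed_field) G \<le> schur_norm_gen TYPE('a) (transpose_bg G)"
  unfolding schur_norm_gen_def
proof (rule SUP_mono, clarsimp)
  fix X :: "nat \<Rightarrow> nat \<Rightarrow> 'a"
  assume X: "mat_norm (rows G) (cols G) X \<le> 1"
  have "schur_prod (transpose_bg G) (\<lambda>j i. X i j) = (\<lambda>j i. schur_prod G X i j)"
    by (simp add: schur_prod_def fun_eq_iff)
  then have "mat_norm (rows G) (cols G) (schur_prod G X)
      = mat_norm (cols G) (rows G) (schur_prod (transpose_bg G) (\<lambda>j i. X i j))"
    by (simp add: mat_norm_transpose[of "cols G" "rows G" "schur_prod G X"])
  then show "\<exists>Y :: nat \<Rightarrow> nat \<Rightarrow> 'a. mat_norm (cols G) (rows G) Y \<le> 1 \<and> mat_norm (rows G) (cols G) (schur_prod G X)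
      \<le> mat_norm (cols G) (rows G) (schur_prod (transpose_bg G) Y)"
    by (intro exI[of _ "\<lambda>j i. X i j"]) (simp add: mat_norm_transpose[of "cols G" "rows G" X] X)
qed

text \<open>Extension by zero: a contraction on \<open>H\<close>, moved along the embedding and
  padded with zeros, is a contraction on \<open>G\<close> whose Schur product has at least the same
  norm.\<close>

lemma schur_norm_gen_mono_embedding:
  assumes f: "inj_on f (rows H)" "f ` rows H \<subseteq> rows G"
    and g: "inj_on g (cols H)" "g ` cols H \<subseteq> cols G"
    and fg: "\<And>r c. r \<in> rows H \<Longrightarrow> c \<in> cols H \<Longrightarrow> (r, c) \<in> edges H \<longleftrightarrow> (f r, g c) \<in> edges G"
  shows "schur_norm_gen TYPE('a::real_normed_field) H \<le> schur_norm_gen TYPE('a) G"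
  unfolding schur_norm_gen_def
proof (rule SUP_mono)
  fix X :: "nat \<Rightarrow> nat \<Rightarrow> 'a"
  assume "X \<in> {X. mat_norm (rows H) (cols H) X \<le> 1}"
  then have X: "mat_norm (rows H) (cols H) X \<le> 1" by simp
  define f' g' where "f' = inv_into (rows H) f" and "g' = inv_into (cols H) g"
  have f'[simp]: "f' (f r) = r" if "r \<in> rows H" for r using f that by (simp add: f'_def)
  have g'[simp]: "g' (g c) = c" if "c \<in> cols H" for c using g that by (simp add: g'_def)
  define Y where "Y i j = (if i \<in> f ` rows H \<and> j \<in> g ` cols H then X (f' i) (g' j) else 0)" for i j
  have "mat_norm (rows G) (cols G) Y \<le> 1"
    unfolding one_ereal_def mat_norm_le_iff
  proof (intro allI impI)
    fix I J :: "nat set" and x y :: "nat \<Rightarrow> 'a"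
    assume I: "finite I" "I \<subseteq> rows G" and J: "finite J" "J \<subseteq> cols G"
      and y: "(\<Sum>i\<in>I. (norm (y i))\<^sup>2) \<le> 1" and x: "(\<Sum>j\<in>J. (norm (x j))\<^sup>2) \<le> 1"
    \<comment> \<open>Test vectors on \<open>G\<close> are pulled back to \<open>H\<close>; indices
      outside the image meet only zero entries of \<open>Y\<close>.\<close>
    define I0 J0 where "I0 = {r \<in> rows H. f r \<in> I}" and "J0 = {c \<in> cols H. g c \<in> J}"
    have inj: "inj_on f I0" "inj_on g J0"
      using f g by (auto simp: I0_def J0_def inj_on_def)
    have sub: "f ` I0 \<subseteq> I" "g ` J0 \<subseteq> J" by (auto simp: I0_def J0_def)
    have fin: "finite I0" "finite J0"
      using inj sub I J by (meson finite_imageD finite_subset)+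
    have "(\<Sum>i\<in>I. \<Sum>j\<in>J. y i * Y i j * x j) = (\<Sum>i\<in>f ` I0. \<Sum>j\<in>J. y i * Y i j * x j)"
      by (rule sum.mono_neutral_right[OF I(1) sub(1)]) (auto simp: Y_def I0_def intro!: sum.neutral)
    also have "\<dots> = (\<Sum>i\<in>f ` I0. \<Sum>j\<in>g ` J0. y i * Y i j * x j)"
      by (rule sum.cong[OF refl], rule sum.mono_neutral_right[OF J(1) sub(2)]) (auto simp: Y_def J0_def)
    also have "\<dots> = (\<Sum>r\<in>I0. \<Sum>c\<in>J0. y (f r) * X r c * x (g c))"
      by (simp add: sum.reindex[OF inj(1)] sum.reindex[OF inj(2)])
        (intro sum.cong refl, auto simp: Y_def I0_def J0_def)
    also have "norm \<dots> \<le> 1"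
    proof -
      have "(\<Sum>r\<in>I0. (norm (y (f r)))\<^sup>2) \<le> 1"
        using sum_mono2[OF I(1) sub(1), of "\<lambda>i. (norm (y i))\<^sup>2"] y by (simp add: sum.reindex[OF inj(1)])
      moreover have "(\<Sum>c\<in>J0. (norm (x (g c)))\<^sup>2) \<le> 1"
        using sum_mono2[OF J(1) sub(2), of "\<lambda>j. (norm (x j))\<^sup>2"] x by (simp add: sum.reindex[OF inj(2)])
      moreover have "I0 \<subseteq> rows H" "J0 \<subseteq> cols H" by (auto simp: I0_def J0_def)
      ultimately show ?thesis
        using X fin by (intro mat_norm_leD[of "rows H" "cols H"])
    qed
    finally show "norm (\<Sum>i\<in>I. \<Sum>j\<in>J. y i * Y i j * x j) \<le> 1" .
  qed
  moreover have "mat_norm (rows H) (cols H) (schur_prod H X) \<le> mat_norm (rows G) (cols G) (schur_prod G Y)"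
    unfolding mat_norm_def[of "rows H"]
  proof (rule SUP_least, clarsimp)
    fix I J and x y :: "nat \<Rightarrow> 'a"
    assume I: "finite I" "I \<subseteq> rows H" and J: "finite J" "J \<subseteq> cols H"
      and y: "(\<Sum>i\<in>I. (norm (y i))\<^sup>2) \<le> 1" and x: "(\<Sum>j\<in>J. (norm (x j))\<^sup>2) \<le> 1"
    have inj: "inj_on f I" "inj_on g J" using f g I J by (meson inj_on_subset)+
    \<comment> \<open>Conversely, test vectors on \<open>H\<close> are pushed forward to the image;
      injectivity preserves their lengths.\<close>
    have "ereal (norm (\<Sum>i\<in>f ` I. \<Sum>j\<in>g ` J. y (f' i) * schur_prod G Y i j * x (g' j)))
        \<le> mat_norm (rows G) (cols G) (schur_prod G Y)"
    proof (rule mat_norm_ge)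
      have "(\<Sum>i\<in>I. (norm (y (f' (f i))))\<^sup>2) = (\<Sum>i\<in>I. (norm (y i))\<^sup>2)"
        by (intro sum.cong refl) (use I in auto)
      then show "(\<Sum>i\<in>f ` I. (norm (y (f' i)))\<^sup>2) \<le> 1" using y by (simp add: sum.reindex[OF inj(1)])
      have "(\<Sum>j\<in>J. (norm (x (g' (g j))))\<^sup>2) = (\<Sum>j\<in>J. (norm (x j))\<^sup>2)"
        by (intro sum.cong refl) (use J in auto)
      then show "(\<Sum>j\<in>g ` J. (norm (x (g' j)))\<^sup>2) \<le> 1" using x by (simp add: sum.reindex[OF inj(2)])
    qed (use f(2) g(2) I J in \<open>auto simp: image_subset_iff subset_iff\<close>)
    also have "(\<Sum>i\<in>f ` I. \<Sum>j\<in>g ` J. y (f' i) * schur_prod G Y i j * x (g' j))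
        = (\<Sum>i\<in>I. \<Sum>j\<in>J. y i * schur_prod H X i j * x j)"
      by (simp add: sum.reindex[OF inj(1)] sum.reindex[OF inj(2)])
        (intro sum.cong refl, use I J fg in \<open>auto simp: Y_def schur_prod_def subset_iff\<close>)
    finally show "ereal (norm (\<Sum>i\<in>I. \<Sum>j\<in>J. y i * schur_prod H X i j * x j))
        \<le> mat_norm (rows G) (cols G) (schur_prod G Y)" .
  qed
  ultimately show "\<exists>Y\<in>{X :: nat \<Rightarrow> nat \<Rightarrow> 'a. mat_norm (rows G) (cols G) X \<le> 1}.
      mat_norm (rows H) (cols H) (schur_prod H X) \<le> mat_norm (rows G) (cols G) (schur_prod G Y)"
    by auto
qed

lemma schur_norm_gen_mono:
  assumes "ind_le H G"
  shows "schur_norm_gen TYPE('a::real_normed_field) H \<le> schur_norm_gen TYPE('a) G"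
  using assms unfolding ind_le_def
proof (elim disjE exE conjE)
  fix f g assume "inj_on f (rows H)" "f ` rows H \<subseteq> rows G" "inj_on g (cols H)" "g ` cols H \<subseteq> cols G"
    "\<forall>r\<in>rows H. \<forall>c\<in>cols H. (r, c) \<in> edges H \<longleftrightarrow> (f r, g c) \<in> edges G"
  then show ?thesis by (intro schur_norm_gen_mono_embedding[of f H G g]) auto
next
  fix f g assume "inj_on f (rows H)" "f ` rows H \<subseteq> cols G" "inj_on g (cols H)" "g ` cols H \<subseteq> rows G"
    "\<forall>r\<in>rows H. \<forall>c\<in>cols H. (r, c) \<in> edges H \<longleftrightarrow> (g c, f r) \<in> edges G"
  then have "schur_norm_gen TYPE('a) (transpose_bg H) \<le> schur_norm_gen TYPE('a) G"
    by (intro schur_norm_gen_mono_embedding[of g "transpose_bg H" G f]) auto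
  then show ?thesis using schur_norm_gen_transpose_le[where 'a = 'a, of H] by order
qed

lemma schur_norm_mono: "ind_le H G \<Longrightarrow> schur_norm F H \<le> schur_norm F G"
  by (cases F) (simp_all add: schur_norm_def schur_norm_gen_mono)

section \<open>Finite certificates for graphs given by matrices\<close>

lemma mat_graph_simps [simp]:
  "rows (mat_graph M) = {..<length M}" "cols (mat_graph M) = {..<length (hd M)}"
  "(i, j) \<in> edges (mat_graph M) \<longleftrightarrow> i < length M \<and> j < length (hd M) \<and> M ! i ! j = 1"
  by (simp_all add: mat_graph_def rows_def cols_def edges_def)

text \<open>The bound is compared through its square \<open>c\<close>, which lies in a quadratic
  field even when \<open>h\<close> does not. Squares appear as products so that a rule reducing
  \<open>s * s\<close> can fire after expansion.\<close>

lemma schur_norm_mat_graph_le: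
  fixes w :: "real list" and a b :: "real list list"
  assumes "h \<ge> 0" and "h\<^sup>2 = c" and "\<forall>k<length w. w ! k \<ge> 0"
    and "\<forall>i<length M. \<forall>j<length (hd M).
      (\<Sum>k<length w. w ! k * a ! i ! k * b ! j ! k) = (if M ! i ! j = 1 then 1 else 0)"
    and "\<forall>i<length M. (\<Sum>k<length w. w ! k * (a ! i ! k * a ! i ! k)) \<le> 1"
    and "\<forall>j<length (hd M). (\<Sum>k<length w. w ! k * (b ! j ! k * b ! j ! k)) \<le> c"
  shows "schur_norm F (mat_graph M) \<le> ereal h"
  by (cases F; simp only: schur_norm_def scalar_field.case;
      rule schur_norm_gen_le[where K = "{..<length w}" and w = "\<lambda>k. w ! k"
        and a = "\<lambda>i k. a ! i ! k" and b = "\<lambda>j k. b ! j ! k"])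
    (use assms in \<open>auto simp: power2_eq_square\<close>)

lemma schur_norm_mat_graph_ge:
  fixes x :: "nat \<Rightarrow> nat \<Rightarrow> real" and u v :: "nat \<Rightarrow> real"
  assumes "\<And>i. i < length M \<Longrightarrow> (\<Sum>k<length M. \<bar>\<Sum>j<length (hd M). x i j * x k j\<bar>) \<le> 1"
    and "(\<Sum>i<length M. (v i)\<^sup>2) \<le> 1" "(\<Sum>j<length (hd M). (u j)\<^sup>2) \<le> 1"
  shows "ereal (\<Sum>i<length M. \<Sum>j<length (hd M). if M ! i ! j = 1 then v i * x i j * u j else 0)
    \<le> schur_norm F (mat_graph M)"
proof -
  have "(\<Sum>i\<in>rows (mat_graph M). \<Sum>j\<in>cols (mat_graph M).
        if (i, j) \<in> edges (mat_graph M) then v i * x i j * u j else 0)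
      = (\<Sum>i<length M. \<Sum>j<length (hd M). if M ! i ! j = 1 then v i * x i j * u j else 0)"
    by (auto intro!: sum.cong)
  moreover have "ereal (\<Sum>i\<in>rows (mat_graph M). \<Sum>j\<in>cols (mat_graph M).
        if (i, j) \<in> edges (mat_graph M) then v i * x i j * u j else 0)
      \<le> schur_norm F (mat_graph M)"
    by (cases F; simp only: schur_norm_def scalar_field.case; rule schur_norm_gen_ge)
      (use assms in auto)
  ultimately show ?thesis by simp
qed

text \<open>The optimal unit vectors have entries \<open>sqrt (p ! i)\<close> and \<open>sqrt (q ! j)\<close>, and the optimal
  contraction has entries \<open>h * U ! i ! j * sqrt (q ! j) / sqrt (p ! i)\<close>; clearing the square roots
  leaves conditions over a quadratic number field.\<close>

lemma schur_norm_mat_graph_ge_quadratic: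
  fixes p q :: "real list" and U :: "real list list"
  assumes h: "h\<^sup>2 = c" and len: "length p = length M" "length q = length (hd M)"
    and p: "\<forall>i<length M. p ! i > 0" and q: "\<forall>j<length (hd M). q ! j > 0"
    and sums: "(\<Sum>i<length M. p ! i) = 1" "(\<Sum>j<length (hd M). q ! j) = 1"
    and orth: "\<forall>i<length M. \<forall>k<length M.
      c * (\<Sum>j<length (hd M). U ! i ! j * U ! k ! j * q ! j) = (if i = k then p ! i else 0)"
    and val: "(\<Sum>i<length M. \<Sum>j<length (hd M). if M ! i ! j = 1 then U ! i ! j * q ! j else 0) = 1"
  shows "ereal h \<le> schur_norm F (mat_graph M)"
proof -
  define v u where "v i = sqrt (p ! i)" and "u j = sqrt (q ! j)" for i j
  define x where "x i j = h * U ! i ! j * u j / v i" for i j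
  have v2: "v i * v i = p ! i" "v i \<noteq> 0" if "i < length M" for i
    using p that by (auto simp: v_def less_imp_neq[symmetric])
  have u2: "u j * u j = q ! j" if "j < length (hd M)" for j
    using q that by (auto simp: u_def less_imp_le)
  \<comment> \<open>The condition \<open>orth\<close> says precisely that the rows of
    \<open>x\<close> are orthonormal, once the factors \<open>v i\<close> and \<open>u j\<close>
    have been squared away.\<close>
  have gram: "(\<Sum>j<length (hd M). x i j * x k j) = (if i = k then 1 else 0)"
    if ik: "i < length M" "k < length M" for i k
  proof -
    have "(\<Sum>j<length (hd M). x i j * x k j)
        = (\<Sum>j<length (hd M). h\<^sup>2 * (U ! i ! j * U ! k ! j * q ! j) / (v i * v k))"
      by (rule sum.cong[OF refl]) (simp add: x_def u2[symmetric] power2_eq_square)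
    also have "\<dots> = (if i = k then p ! i else 0) / (v i * v k)"
      using orth ik by (simp add: h sum_divide_distrib[symmetric] sum_distrib_left[symmetric])
    also have "\<dots> = (if i = k then 1 else 0)"
      using v2[OF ik(1)] p ik by auto
    finally show ?thesis .
  qed
  have "ereal (\<Sum>i<length M. \<Sum>j<length (hd M). if M ! i ! j = 1 then v i * x i j * u j else 0)
      \<le> schur_norm F (mat_graph M)"
  proof (rule schur_norm_mat_graph_ge)
    fix i assume i: "i < length M"
    have "(\<Sum>k<length M. \<bar>\<Sum>j<length (hd M). x i j * x k j\<bar>) = (\<Sum>k<length M. if i = k then 1 else 0)"
      by (rule sum.cong[OF refl]) (use gram i in auto)
    then show "(\<Sum>k<length M. \<bar>\<Sum>j<length (hd M). x i j * x k j\<bar>) \<le> 1" using i by simp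
  next
    show "(\<Sum>i<length M. (v i)\<^sup>2) \<le> 1"
      using sums v2 by (simp add: power2_eq_square)
    show "(\<Sum>j<length (hd M). (u j)\<^sup>2) \<le> 1"
      using sums u2 by (simp add: power2_eq_square)
  qed
  also have "(\<Sum>i<length M. \<Sum>j<length (hd M). if M ! i ! j = 1 then v i * x i j * u j else 0)
      = (\<Sum>i<length M. \<Sum>j<length (hd M). h * (if M ! i ! j = 1 then U ! i ! j * q ! j else 0))"
    \<comment> \<open>The factor \<open>v i\<close> cancels and \<open>u j\<close> occurs twice, so
      every term becomes \<open>h * U ! i ! j * q ! j\<close> on the edges.\<close>
    by (intro sum.cong refl) (use v2 u2 in \<open>auto simp: x_def mult.assoc\<close>)
  also have "\<dots> = h"
    using val by (simp add: sum_distrib_left[symmetric])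
  finally show ?thesis .
qed

text \<open>The rows of \<open>N\<close> are \<open>s\<close> times nearly orthonormal vectors; dominating the Gram matrix by row
  sums lets the entries be small integers.\<close>

lemma schur_norm_mat_graph_gt:
  fixes N :: "real list list" and v u :: "real list"
  assumes pos: "s > 0" "V > 0" "W > 0"
    and gram: "\<forall>i<length M. (\<Sum>k<length M. \<bar>\<Sum>j<length (hd M). N ! i ! j * N ! k ! j\<bar>) \<le> s\<^sup>2"
    and v: "(\<Sum>i<length M. (v ! i)\<^sup>2) \<le> V\<^sup>2" and u: "(\<Sum>j<length (hd M). (u ! j)\<^sup>2) \<le> W\<^sup>2"
    and val: "c * (V * s * W)
      < (\<Sum>i<length M. \<Sum>j<length (hd M). if M ! i ! j = 1 then v ! i * N ! i ! j * u ! j else 0)"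
  shows "ereal c < schur_norm F (mat_graph M)"
proof -
  have "ereal c < ereal (\<Sum>i<length M. \<Sum>j<length (hd M).
      if M ! i ! j = 1 then v ! i / V * (N ! i ! j / s) * (u ! j / W) else 0)"
  proof -
    have "(\<Sum>i<length M. \<Sum>j<length (hd M).
        if M ! i ! j = 1 then v ! i / V * (N ! i ! j / s) * (u ! j / W) else 0)
      = (\<Sum>i<length M. \<Sum>j<length (hd M).
          if M ! i ! j = 1 then v ! i * N ! i ! j * u ! j else 0) / (V * s * W)"
      unfolding sum_divide_distrib by (intro sum.cong refl) simp
    then show ?thesis using val pos by (simp add: pos_less_divide_eq)
  qed
  also have "\<dots> \<le> schur_norm F (mat_graph M)"
  proof (rule schur_norm_mat_graph_ge)
    fix i assume i: "i < length M"
    have "(\<Sum>k<length M. \<bar>\<Sum>j<length (hd M). N ! i ! j / s * (N ! k ! j / s)\<bar>)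
        = (\<Sum>k<length M. \<bar>\<Sum>j<length (hd M). N ! i ! j * N ! k ! j\<bar>) / s\<^sup>2"
      by (simp add: power2_eq_square sum_divide_distrib[symmetric] abs_mult)
    then show "(\<Sum>k<length M. \<bar>\<Sum>j<length (hd M). N ! i ! j / s * (N ! k ! j / s)\<bar>) \<le> 1"
      using gram i pos by simp
  next
    show "(\<Sum>i<length M. (v ! i / V)\<^sup>2) \<le> 1"
      using v pos by (simp add: power_divide sum_divide_distrib[symmetric])
    show "(\<Sum>j<length (hd M). (u ! j / W)\<^sup>2) \<le> 1"
      using u pos by (simp add: power_divide sum_divide_distrib[symmetric])
  qed
  finally show ?thesis .
qed

section \<open>Certificates for the graphs \<open>F_graph k\<close> and
  \<open>E_graph k\<close>\<close>

lemma schur_norm_F2: "schur_norm F (F_graph 2) \<le> ereal (eta 2)"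
proof -
  have h: "(eta 2)\<^sup>2 = 4/3" "eta 2 \<ge> 0"
    by (simp_all add: eta_def)
  show ?thesis
    unfolding F_graph_def
    by (rule schur_norm_mat_graph_le[OF h(2,1), where w = "[1, 3/4]"
      and a = "[[1, 0],
      [1/2, 1]]"
      and b = "[[1, -2/3],
      [1, 2/3],
      [0, 4/3]]"])
      (simp_all add: All_less_Suc lessThan_Suc algebra_simps add_divide_distrib diff_divide_distrib, (((intro conjI)?; linarith)+)?)
qed

text \<open>The list \<open>q\<close> is \<open>p\<close> reversed, reflecting the symmetry of the
  path that exchanges its two sides; the same holds for the longer paths \<open>E_graph 3\<close>
  and \<open>E_graph 6\<close>.\<close>

lemma schur_norm_E2: "ereal (eta 2) \<le> schur_norm F (E_graph 2)"
proof -
  have h: "(eta 2)\<^sup>2 = 4/3" "eta 2 \<ge> 0"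
    by (simp_all add: eta_def)
  show ?thesis
    unfolding E_graph_def
    by (rule schur_norm_mat_graph_ge_quadratic[OF h(1), where p = "[2/3, 1/3]"
      and q = "[1/3, 2/3]"
      and U = "[[1, 1/2],
      [-1/2, 1/2]]"])
      (simp_all add: All_less_Suc lessThan_Suc algebra_simps add_divide_distrib diff_divide_distrib, (((intro conjI)?; linarith)+)?)
qed

lemma schur_norm_F3: "schur_norm F (F_graph 3) \<le> ereal (eta 3)"
proof -
  define s where "s = sqrt 2"
  have ss: "s * s = 2" "\<And>y. s * (s * y) = 2 * y"
    by (simp_all add: s_def mult.assoc[symmetric])
  have bnd: "14/10 < s" "s < 15/10"
    unfolding s_def by (rule real_less_rsqrt real_less_lsqrt; simp add: power2_eq_square)+
  have h: "(eta 3)\<^sup>2 = 3/4 + 1/2 * s" "eta 3 \<ge> 0"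
    using ss bnd by (simp_all add: eta_def s_def[symmetric] power2_eq_square field_simps)
  \<comment> \<open>In cyclic order the four rows of the 8-cycle carry the constant, cosine and sine
    modes, whose values are the columns of \<open>a\<close>. The alternating mode is absent: every
    column is adjacent to two consecutive rows, so it cancels there.\<close>
  show ?thesis
    unfolding F_graph_def
    by (rule schur_norm_mat_graph_le[OF h(2,1), where w = "[-1 + s, 2 - s, 2 - s]"
      and a = "[[1, 1, 0],
      [1, 0, 1],
      [1, 0, -1],
      [1, -1, 0]]"
      and b = "[[1/2 + 1/2 * s, 1/2 + 1/4 * s, 1/2 + 1/4 * s],
      [1/2 + 1/2 * s, 1/2 + 1/4 * s, -1/2 - 1/4 * s],
      [1/2 + 1/2 * s, -1/2 - 1/4 * s, 1/2 + 1/4 * s],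
      [1/2 + 1/2 * s, -1/2 - 1/4 * s, -1/2 - 1/4 * s]]"])
      (use bnd in \<open>simp_all add: All_less_Suc lessThan_Suc algebra_simps add_divide_distrib diff_divide_distrib ss, (((intro conjI)?; linarith)+)?\<close>)
qed

lemma schur_norm_E3: "ereal (eta 3) \<le> schur_norm F (E_graph 3)"
proof -
  define s where "s = sqrt 2"
  have ss: "s * s = 2" "\<And>y. s * (s * y) = 2 * y"
    by (simp_all add: s_def mult.assoc[symmetric])
  have bnd: "14/10 < s" "s < 15/10"
    unfolding s_def by (rule real_less_rsqrt real_less_lsqrt; simp add: power2_eq_square)+
  have h: "(eta 3)\<^sup>2 = 3/4 + 1/2 * s" "eta 3 \<ge> 0"
    using ss bnd by (simp_all add: eta_def s_def[symmetric] power2_eq_square field_simps)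
  show ?thesis
    unfolding E_graph_def
    by (rule schur_norm_mat_graph_ge_quadratic[OF h(1), where p = "[1/4 * s, 1/2, 1/2 - 1/4 * s]"
      and q = "[1/2 - 1/4 * s, 1/2, 1/4 * s]"
      and U = "[[1, -1 + s, -3 + 2 * s],
      [-2 + s, 2 - s, 2 - s],
      [-1 + s, -3 + 2 * s, -1 + s]]"])
      (use bnd in \<open>simp_all add: All_less_Suc lessThan_Suc algebra_simps add_divide_distrib diff_divide_distrib ss, (((intro conjI)?; linarith)+)?\<close>)
qed

lemma schur_norm_F4: "schur_norm F (F_graph 4) \<le> ereal (eta 4)"
proof -
  define s where "s = sqrt 19"
  have ss: "s * s = 19" "\<And>y. s * (s * y) = 19 * y"
    by (simp_all add: s_def mult.assoc[symmetric])
  \<comment> \<open>Expansion leaves expressions linear in \<open>s\<close>; these bounds settle the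
    signs of the weights and the remaining strict inequalities.\<close>
  have bnd: "435/100 < s" "s < 436/100"
    unfolding s_def by (rule real_less_rsqrt real_less_lsqrt; simp add: power2_eq_square)+
  have h: "(eta 4)\<^sup>2 = 169/225 + 38/225 * s" "eta 4 \<ge> 0"
    using bnd by (simp_all add: eta_def s_def[symmetric] power_mult_distrib power_divide field_simps)
  show ?thesis
    unfolding F_graph_def
    by (rule schur_norm_mat_graph_le[OF h(2,1), where w = "[1, -34 + 8 * s, 83/18 - 8/9 * s]"
      and a = "[[1, 0, 0],
      [-4 + s, 1, 0],
      [-5/3 + 1/3 * s, 1/2, 1]]"
      and b = "[[1, 3/10 + 1/10 * s, -37/225 + 1/225 * s],
      [0, 17/30 + 2/15 * s, -83/225 - 16/225 * s],
      [0, 17/30 + 2/15 * s, 83/225 + 16/225 * s],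
      [1, -4/15 - 1/30 * s, 46/225 + 17/225 * s],
      [0, 0, 166/225 + 32/225 * s]]"])
      (use bnd in \<open>simp_all add: All_less_Suc lessThan_Suc algebra_simps add_divide_distrib diff_divide_distrib ss, (((intro conjI)?; linarith)+)?\<close>)
qed

lemma schur_norm_E4: "ereal (eta 4) \<le> schur_norm F (E_graph 4)"
proof -
  define s where "s = sqrt 19"
  have ss: "s * s = 19" "\<And>y. s * (s * y) = 19 * y"
    by (simp_all add: s_def mult.assoc[symmetric])
  have bnd: "435/100 < s" "s < 436/100"
    unfolding s_def by (rule real_less_rsqrt real_less_lsqrt; simp add: power2_eq_square)+
  have h: "(eta 4)\<^sup>2 = 169/225 + 38/225 * s" "eta 4 \<ge> 0"
    using bnd by (simp_all add: eta_def s_def[symmetric] power_mult_distrib power_divide field_simps)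
  show ?thesis
    unfolding E_graph_def
    by (rule schur_norm_mat_graph_ge_quadratic[OF h(1), where p = "[1/3 - 1/30 * s, 1/3 + 1/15 * s, 1/3 - 1/30 * s]"
      and q = "[4/15 + 1/30 * s, 7/15 - 1/15 * s, 4/15 + 1/30 * s]"
      and U = "[[11/5 - 2/5 * s, -11/5 + 2/5 * s, -31/5 + 7/5 * s],
      [-6/5 + 2/5 * s, 1, -6/5 + 2/5 * s],
      [-31/5 + 7/5 * s, -11/5 + 2/5 * s, 11/5 - 2/5 * s]]"])
      (use bnd in \<open>simp_all add: All_less_Suc lessThan_Suc algebra_simps add_divide_distrib diff_divide_distrib ss, (((intro conjI)?; linarith)+)?\<close>)
qed

text \<open>The rows are represented by three unit vectors with pairwise inner products 1/2, in
  Cholesky form.\<close>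

lemma schur_norm_F5: "schur_norm F (F_graph 5) \<le> ereal (eta 5)"
proof -
  have h: "(eta 5)\<^sup>2 = 3/2" "eta 5 \<ge> 0"
    by (simp_all add: eta_def)
  show ?thesis
    unfolding F_graph_def
    by (rule schur_norm_mat_graph_le[OF h(2,1), where w = "[1, 3/4, 2/3]"
      and a = "[[1, 0, 0],
      [1/2, 1, 0],
      [1/2, 1/3, 1]]"
      and b = "[[1, 2/3, 1/2],
      [1, -2/3, -1/2],
      [0, 4/3, -1/2],
      [0, 0, 3/2]]"])
      (simp_all add: All_less_Suc lessThan_Suc algebra_simps add_divide_distrib diff_divide_distrib, (((intro conjI)?; linarith)+)?)
qed

lemma schur_norm_E5: "ereal (eta 5) \<le> schur_norm F (E_graph 5)"
proof -
  have h: "(eta 5)\<^sup>2 = 3/2" "eta 5 \<ge> 0"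
    by (simp_all add: eta_def)
  show ?thesis
    unfolding E_graph_def
    by (rule schur_norm_mat_graph_ge_quadratic[OF h(1), where p = "[1/3, 1/3, 1/3]"
      and q = "[5/8, 1/8, 1/8, 1/8]"
      and U = "[[1/3, 1, -1/3, -1/3],
      [1/3, -1/3, 1, -1/3],
      [1/3, -1/3, -1/3, 1]]"])
      (simp_all add: All_less_Suc lessThan_Suc algebra_simps add_divide_distrib diff_divide_distrib, (((intro conjI)?; linarith)+)?)
qed

lemma schur_norm_F6: "schur_norm F (F_graph 6) \<le> ereal (eta 6)"
proof -
  define s where "s = sqrt 5"
  have ss: "s * s = 5" "\<And>y. s * (s * y) = 5 * y"
    by (simp_all add: s_def mult.assoc[symmetric])
  have bnd: "223/100 < s" "s < 224/100"
    unfolding s_def by (rule real_less_rsqrt real_less_lsqrt; simp add: power2_eq_square)+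
  have h: "(eta 6)\<^sup>2 = 4/5 + 8/25 * s" "eta 6 \<ge> 0"
    using bnd by (simp_all add: eta_def s_def[symmetric] power_mult_distrib power_divide field_simps)
  show ?thesis
    unfolding F_graph_def
    by (rule schur_norm_mat_graph_le[OF h(2,1), where w = "[1, -5/2 + 3/2 * s, -5/8 + 5/8 * s, 25/4 - 5/2 * s]"
      and a = "[[1, 0, 0, 0],
      [3/2 - 1/2 * s, 1, 0, 0],
      [1 - 1/2 * s, 1/2, 1, 0],
      [-1 + 1/2 * s, -3/4 + 1/4 * s, -1/2 + 1/2 * s, 1]]"
      and b = "[[1, -1/5 * s, 2/5, -2/5 - 2/25 * s],
      [1, 1/2 + 1/10 * s, 1/5 - 1/5 * s, 2/25 * s],
      [0, 1/2 + 3/10 * s, 1/5 + 1/5 * s, -2/25 * s],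
      [0, 0, 2/5 + 2/5 * s, 2/5 + 2/25 * s],
      [0, 0, 0, 4/5 + 8/25 * s]]"])
      (use bnd in \<open>simp_all add: All_less_Suc lessThan_Suc algebra_simps add_divide_distrib diff_divide_distrib ss, (((intro conjI)?; linarith)+)?\<close>)
qed

lemma schur_norm_E6: "ereal (eta 6) \<le> schur_norm F (E_graph 6)"
proof -
  define s where "s = sqrt 5"
  have ss: "s * s = 5" "\<And>y. s * (s * y) = 5 * y"
    by (simp_all add: s_def mult.assoc[symmetric])
  have bnd: "223/100 < s" "s < 224/100"
    unfolding s_def by (rule real_less_rsqrt real_less_lsqrt; simp add: power2_eq_square)+
  have h: "(eta 6)\<^sup>2 = 4/5 + 8/25 * s" "eta 6 \<ge> 0"
    using bnd by (simp_all add: eta_def s_def[symmetric] power_mult_distrib power_divide field_simps)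
  show ?thesis
    unfolding E_graph_def
    by (rule schur_norm_mat_graph_ge_quadratic[OF h(1), where p = "[1/5, 2/5, 1/10 + 1/10 * s, 3/10 - 1/10 * s]"
      and q = "[3/10 - 1/10 * s, 1/10 + 1/10 * s, 2/5, 1/5]"
      and U = "[[1, 3/2 - 1/2 * s, 1 - 1/2 * s, -1 + 1/2 * s],
      [1/2 - 1/2 * s, -1/2 + 1/2 * s, 1/2, 2 - s],
      [1/2, 2 - s, 1/2, -1/2 + 1/2 * s],
      [-3/2 + 1/2 * s, -1 + 1/2 * s, 1 - 1/2 * s, 3/2 - 1/2 * s]]"])
      (use bnd in \<open>simp_all add: All_less_Suc lessThan_Suc algebra_simps add_divide_distrib diff_divide_distrib ss, (((intro conjI)?; linarith)+)?\<close>)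
qed

lemma schur_norm_F1: "schur_norm F (F_graph 1) \<le> ereal (eta 1)"
  unfolding F_graph_def
  by (rule schur_norm_mat_graph_le[where c = 1 and w = "[1]" and a = "[[1]]" and b = "[[1]]"])
    (simp_all add: eta_def)

lemma schur_norm_E1: "ereal (eta 1) \<le> schur_norm F (E_graph 1)"
  unfolding E_graph_def
  by (rule schur_norm_mat_graph_ge_quadratic[where c = 1 and p = "[1]" and q = "[1]" and U = "[[1]]"])
    (simp_all add: eta_def)

section \<open>Graphs of norm greater than \<open>eta 6\<close>\<close>

definition staircase3_mat :: "nat list list" where
  "staircase3_mat = [[1, 1, 0], [1, 1, 1], [0, 1, 0]]"

text \<open>Two 4-cycles sharing an edge. In \<open>staircase3_mat\<close> the second cycle is
  opened, which leaves a 4-cycle with pendant vertices at two adjacent vertices.\<close>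

definition band3_mat :: "nat list list" where
  "band3_mat = [[1, 1, 0], [1, 1, 1], [0, 1, 1]]"

definition cycle6_mat :: "nat list list" where
  "cycle6_mat = [[1, 1, 0], [0, 1, 1], [1, 0, 1]]"

text \<open>The digits in the name of a spider are the lengths of its legs; row 0 is the
  centre.\<close>

definition spider2221_mat :: "nat list list" where
  "spider2221_mat = [[1, 1, 1, 1], [1, 0, 0, 0], [0, 1, 0, 0], [0, 0, 1, 0]]"

text \<open>Row 0 and column 0 are adjacent, and each carries in addition one leaf and one leg of
  length 2.\<close>

definition adjacent_deg3_mat :: "nat list list" where
  "adjacent_deg3_mat = [[1, 1, 1, 0], [1, 0, 0, 1], [1, 0, 0, 0], [0, 1, 0, 0]]"

definition spider322_mat :: "nat list list" where
  "spider322_mat = [[1, 1, 1, 0], [1, 0, 0, 1], [0, 1, 0, 0], [0, 0, 1, 0]]"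

text \<open>Rows 0 and 1 share the neighbour column 0, and each carries in addition one leaf and one
  leg of length 2.\<close>

definition distance2_deg3_mat :: "nat list list" where
  "distance2_deg3_mat = [[1, 1, 1, 0, 0], [1, 0, 0, 1, 1], [0, 1, 0, 0, 0], [0, 0, 0, 1, 0]]"

definition spider421_mat :: "nat list list" where
  "spider421_mat = [[1, 1, 1, 0], [1, 0, 0, 1], [0, 1, 0, 0], [0, 0, 0, 1]]"

definition path10_mat :: "nat list list" where
  "path10_mat = [[1, 1, 0, 0, 0], [0, 1, 1, 0, 0], [0, 0, 1, 1, 0], [0, 0, 0, 1, 1], [0, 0, 0, 0, 1]]"

definition cycle10_mat :: "nat list list" where
  "cycle10_mat = [[1, 1, 0, 0, 0], [0, 1, 1, 0, 0], [0, 0, 1, 1, 0], [0, 0, 0, 1, 1], [1, 0, 0, 0, 1]]"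

section \<open>Order of the constants and lower bounds for the forbidden graphs\<close>

lemma eta6_less: "ereal (2463/2000) < x \<Longrightarrow> ereal (eta 6) < x"
proof -
  \<comment> \<open>The constant \<open>eta 6\<close> is about 1.23107, so 1.2315 is a rational
    threshold just above it that integer certificates can beat.\<close>
  have "sqrt 5 < 22361/10000"
    by (rule real_less_lsqrt) (simp_all add: power2_eq_square)
  then have "sqrt (5 + 2 * sqrt 5) < 30778/10000"
    by (intro real_less_lsqrt) (simp_all add: power2_eq_square)
  then have "eta 6 < 2463/2000" by (simp add: eta_def)
  then show "ereal (2463/2000) < x \<Longrightarrow> ereal (eta 6) < x"
    by (meson ereal_less(2) less_trans less_ereal.simps(1))
qed

lemma eta_less_Suc: "k < 6 \<Longrightarrow> eta k < eta (Suc k)"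
proof -
  have "1 < sqrt (4/3)" by simp
  moreover have "sqrt (4/3) < 116/100"
    by (rule real_less_lsqrt) (simp_all add: power2_eq_square)
  moreover have "141/100 < sqrt 2"
    by (rule real_less_rsqrt) (simp add: power2_eq_square)
  moreover have "sqrt 2 < 142/100"
    by (rule real_less_lsqrt) (simp_all add: power2_eq_square)
  moreover have 19: "435/100 < sqrt 19" "sqrt 19 < 436/100"
    by (rule real_less_rsqrt real_less_lsqrt; simp add: power2_eq_square)+
  \<comment> \<open>Rational separators: 1815/1500 = 1.21 lies between \<open>eta 3\<close> and
    \<open>eta 4\<close>, and 183/150 = 1.22 in the next bound lies between \<open>eta 4\<close> and
    \<open>eta 5\<close>.\<close>
  have "1815/100 < sqrt (169 + 38 * sqrt 19)"
    by (rule real_less_rsqrt) (use 19 in \<open>simp add: power2_eq_square\<close>)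
  moreover have "sqrt (169 + 38 * sqrt 19) < 183/10"
    by (rule real_less_lsqrt) (use 19 in \<open>simp_all add: power2_eq_square\<close>)
  moreover have "1224/1000 < sqrt (3/2)"
    by (rule real_less_rsqrt) (simp add: power2_eq_square)
  moreover have "sqrt (3/2) < 1225/1000"
    by (rule real_less_lsqrt) (simp_all add: power2_eq_square)
  moreover have "223/100 < sqrt 5"
    by (rule real_less_rsqrt) (simp add: power2_eq_square)
  then have "307/100 < sqrt (5 + 2 * sqrt 5)"
    by (intro real_less_rsqrt) (simp add: power2_eq_square)
  moreover assume "k < 6"
  then have "k = 0 \<or> k = 1 \<or> k = 2 \<or> k = 3 \<or> k = 4 \<or> k = 5" by arith
  ultimately show "eta k < eta (Suc k)"
    by (elim disjE) (simp_all add: eta_def)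
qed

lemma schur_norm_staircase3: "ereal (eta 6) < schur_norm F (mat_graph staircase3_mat)"
  by (rule eta6_less, rule schur_norm_mat_graph_gt[where s = 19 and V = 10 and W = 17
      and N = "[[13, 8, -11], [8, 8, 15], [-11, 15, -2]]"
      and v = "[5, 7, 5]" and u = "[9, 12, 8]"])
    (simp_all add: staircase3_mat_def lessThan_Suc All_less_Suc)

lemma schur_norm_band3: "ereal (eta 6) < schur_norm F (mat_graph band3_mat)"
  by (rule eta6_less, rule schur_norm_mat_graph_gt[where s = 9 and V = 11 and W = 11
      and N = "[[4, 6, -5], [6, 1, 6], [-5, 6, 4]]"
      and v = "[6, 7, 6]" and u = "[6, 7, 6]"])
    (simp_all add: band3_mat_def lessThan_Suc All_less_Suc)

text \<open>Here \<open>N\<close> divided by 3 is exactly orthogonal, and uniform vectors suit the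
  rotational symmetry of the cycle; the 10-cycle below also uses a circulant matrix and uniform
  vectors.\<close>

lemma schur_norm_cycle6: "ereal (eta 6) < schur_norm F (mat_graph cycle6_mat)"
  by (rule eta6_less, rule schur_norm_mat_graph_gt[where s = 3 and V = 7 and W = 7
      and N = "[[2, 2, -1], [-1, 2, 2], [2, -1, 2]]"
      and v = "[4, 4, 4]" and u = "[4, 4, 4]"])
    (simp_all add: cycle6_mat_def lessThan_Suc All_less_Suc)

lemma schur_norm_spider2221: "ereal (eta 6) < schur_norm F (mat_graph spider2221_mat)"
  by (rule eta6_less, rule schur_norm_mat_graph_gt[where s = 6 and V = 14 and W = 11
      and N = "[[3, 3, 3, 3], [5, -1, -1, -3], [-1, 5, -1, -3], [-1, -1, 5, -3]]"
      and v = "[11, 5, 5, 5]" and u = "[6, 6, 6, 3]"])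
    (simp_all add: spider2221_mat_def lessThan_Suc All_less_Suc)

lemma schur_norm_adjacent_deg3: "ereal (eta 6) < schur_norm F (mat_graph adjacent_deg3_mat)"
  by (rule eta6_less, rule schur_norm_mat_graph_gt[where s = 19 and V = 31 and W = 31
      and N = "[[10, 10, 12, -2], [10, -3, -3, 15], [12, -3, -9, -10], [-2, 15, -10, 2]]"
      and v = "[22, 16, 11, 10]" and u = "[22, 16, 11, 10]"])
    (simp_all add: adjacent_deg3_mat_def lessThan_Suc All_less_Suc)

lemma schur_norm_spider322: "ereal (eta 6) < schur_norm F (mat_graph spider322_mat)"
  by (rule eta6_less, rule schur_norm_mat_graph_gt[where s = 58 and V = 11 and W = 15
      and N = "[[35, 30, 30, -15], [37, -11, -11, 41], [-19, 46, -11, 26], [-19, -11, 46, 26]]"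
      and v = "[8, 5, 4, 4]" and u = "[9, 8, 8, 4]"])
    (simp_all add: spider322_mat_def lessThan_Suc All_less_Suc)

lemma schur_norm_distance2_deg3: "ereal (eta 6) < schur_norm F (mat_graph distance2_deg3_mat)"
  by (rule eta6_less, rule schur_norm_mat_graph_gt[where s = 52 and V = 19 and W = 40
      and N = "[[33, 28, 24, -9, -12], [33, -9, -12, 28, 24], [-13, 42, -21, 6, 16], [-13, 6, 16, 42, -21]]"
      and v = "[12, 12, 6, 6]" and u = "[26, 19, 10, 19, 10]"])
    (simp_all add: distance2_deg3_mat_def lessThan_Suc All_less_Suc)

lemma schur_norm_spider421: "ereal (eta 6) < schur_norm F (mat_graph spider421_mat)"
  by (rule eta6_less, rule schur_norm_mat_graph_gt[where s = 43 and V = 40 and W = 34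
      and N = "[[24, 23, 26, -7], [31, -7, -16, 24], [-8, 35, -22, 6], [-15, 4, 20, 34]]"
      and v = "[27, 23, 14, 12]" and u = "[22, 18, 11, 15]"])
    (simp_all add: spider421_mat_def lessThan_Suc All_less_Suc)

lemma schur_norm_path10: "ereal (eta 6) < schur_norm F (mat_graph path10_mat)"
  by (rule eta6_less, rule schur_norm_mat_graph_gt[where s = 104 and V = 16 and W = 16
      and N = "[[78, 62, -21, 14, -13], [-32, 70, 64, -22, 14], [25, -27, 69, 64, -21], [-27, 22, -27, 70, 62], [47, -27, 25, -32, 78]]"
      and v = "[6, 9, 9, 7, 3]" and u = "[3, 7, 9, 9, 6]"])
    (simp_all add: path10_mat_def lessThan_Suc All_less_Suc)

lemma schur_norm_cycle10: "ereal (eta 6) < schur_norm F (mat_graph cycle10_mat)"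
  by (rule eta6_less, rule schur_norm_mat_graph_gt[where s = 25 and V = 9 and W = 9
      and N = "[[16, 16, -6, 5, -6], [-6, 16, 16, -6, 5], [5, -6, 16, 16, -6], [-6, 5, -6, 16, 16], [16, -6, 5, -6, 16]]"
      and v = "[4, 4, 4, 4, 4]" and u = "[4, 4, 4, 4, 4]"])
    (simp_all add: cycle10_mat_def lessThan_Suc All_less_Suc)

abbreviation forbidden_mats :: "nat list list set" where
  "forbidden_mats \<equiv> {staircase3_mat, band3_mat, cycle6_mat, spider2221_mat, adjacent_deg3_mat,
     spider322_mat, distance2_deg3_mat, spider421_mat, path10_mat, cycle10_mat}"

text \<open>The paths on 2, 4, 5, 6, 7, 8, 9 vertices and the 8-cycle.\<close>

abbreviation path_mats :: "nat list list set" where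
  "path_mats \<equiv> {[[1]], [[1,1],[0,1]], [[1,1,0],[0,1,1]], [[1,1,0],[0,1,1],[0,0,1]],
     [[1,1,0,0],[0,1,1,0],[0,0,1,1]], [[1,1,0,0],[1,0,1,0],[0,1,0,1],[0,0,1,1]],
     [[1,1,0,0],[0,1,1,0],[0,0,1,1],[0,0,0,1]], [[1,1,0,0,0],[0,1,1,0,0],[0,0,1,1,0],[0,0,0,1,1]]}"

text \<open>The spiders with legs of lengths (2,2,1), (3,2,1), (3,3,1) and (2,2,2).\<close>

abbreviation spider_mats :: "nat list list set" where
  "spider_mats \<equiv> {[[1,0,0],[1,1,1],[0,0,1]], [[1,0,0,1],[1,1,1,0],[0,0,1,0]],
     [[1,0,0,1,0],[1,1,1,0,0],[0,0,1,0,1]], [[1,1,0,0],[1,0,1,0],[1,0,0,1]]}"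

section \<open>Classification of connected twin-free graphs without forbidden subgraphs\<close>

text \<open>One vertex type with a 2-colouring replaces the two sides, so each argument applies
  equally with rows and columns exchanged.\<close>

locale bipartite =
  fixes A :: "'v \<Rightarrow> 'v \<Rightarrow> bool" and colour :: "'v \<Rightarrow> bool" and V :: "'v set"
  assumes adj_sym: "A u v \<Longrightarrow> A v u"
    and adj_colour: "A u v \<Longrightarrow> colour v = (\<not> colour u)"
    and adj_V: "A u v \<Longrightarrow> v \<in> V"
begin

text \<open>Either colour class may supply \<open>rs\<close>, matching the side swap in
  \<open>ind_le\<close>. Distinctness of the entries is recovered in \<open>mat_graph_embeds\<close>
  from twin-freeness of the matrix.\<close>

definition pattern :: "nat list list \<Rightarrow> 'v list \<Rightarrow> 'v list \<Rightarrow> bool" where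
  "pattern M rs cs \<longleftrightarrow> length rs = length M \<and> length cs = length (hd M) \<and> set rs \<union> set cs \<subseteq> V \<and>
     (\<forall>r\<in>set rs. \<forall>c\<in>set cs. colour c = (\<not> colour r)) \<and>
     (\<forall>i<length M. \<forall>j<length (hd M). A (rs ! i) (cs ! j) \<longleftrightarrow> M ! i ! j = 1)"

end

text \<open>The assumption \<open>closed_eq_V\<close> is connectedness in the form used below: once
  the neighbourhoods of a few known vertices stay among them, these vertices are the whole
  graph.\<close>

locale small_norm_graph = bipartite A colour V
  for A :: "'v \<Rightarrow> 'v \<Rightarrow> bool" and colour and V +
  assumes twins: "u \<in> V \<Longrightarrow> v \<in> V \<Longrightarrow> colour u = colour v \<Longrightarrow> (\<And>w. A u w \<longleftrightarrow> A v w) \<Longrightarrow> u = v"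
    and closed_eq_V: "u \<in> S \<Longrightarrow> S \<subseteq> V \<Longrightarrow> (\<And>x y. x \<in> S \<Longrightarrow> A x y \<Longrightarrow> y \<in> S) \<Longrightarrow> V = S"
    and edge_exists: "\<exists>u v. A u v"
    and forbidden: "M \<in> forbidden_mats \<Longrightarrow> \<not> pattern M rs cs"
begin

section \<open>Exclusion of 4-cycles and 6-cycles\<close>

lemma no_4cycle_aux:
  assumes "A r1 c1" "A r1 c2" "A r2 c1" "A r2 c2" "\<not> A r1 c3" "A r2 c3" "\<not> A r3 c1" "A r3 c2"
  shows False
proof -
  have col: "colour c1 = (\<not> colour r1)" "colour c2 = (\<not> colour r1)" "colour r2 = colour r1"
    "colour c3 = (\<not> colour r1)" "colour r3 = colour r1"
    using assms(1-4,6,8)[THEN adj_colour] by blast+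
  have V: "{r1, r2, r3, c1, c2, c3} \<subseteq> V"
    using assms adj_V adj_sym by blast
  \<comment> \<open>The adjacency of \<open>r3\<close> and \<open>c3\<close> is the only entry left
    open, and both of its values give a forbidden graph.\<close>
  have "pattern (if A r3 c3 then band3_mat else staircase3_mat) [r1, r2, r3] [c1, c2, c3]"
    using assms V by (simp add: pattern_def band3_mat_def staircase3_mat_def All_less_Suc col)
  then show False
    using forbidden[of band3_mat] forbidden[of staircase3_mat] by (auto split: if_splits)
qed

text \<open>Twin-freeness supplies a vertex separating each opposite pair of the cycle. The four
  uses of the previous lemma record which vertex of each pair sees its separator.\<close>

lemma no_4cycle:
  assumes A: "A a b" "A b c" "A c d" and neq: "a \<noteq> c" "b \<noteq> d"
  shows "\<not> A a d"
proof
  assume ad: "A a d"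
  have V: "a \<in> V" "b \<in> V" "c \<in> V" "d \<in> V" using A ad adj_V adj_sym by blast+
  have "colour a = colour c" "colour b = colour d" using A[THEN adj_colour] ad[THEN adj_colour] by blast+
  then obtain x y where xy: "A a x \<noteq> A c x" "A b y \<noteq> A d y"
    using twins V neq by metis
  note aux = no_4cycle_aux[of a b d c x y] no_4cycle_aux[of c b d a x y]
    no_4cycle_aux[of a d b c x y] no_4cycle_aux[of c d b a x y]
  show False using A neq ad xy aux adj_sym by blast
qed

text \<open>Without 4-cycles a closed walk of this kind has six distinct vertices and no long
  diagonals, so it is an induced 6-cycle.\<close>

lemma no_6cycle:
  assumes A: "A a b" "A b c" "A c d" "A d e" "A e f" and neq: "a \<noteq> c" "b \<noteq> d" "c \<noteq> e" "d \<noteq> f"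
  shows "\<not> A a f"
proof
  assume af: "A a f"
  have "a \<noteq> e" using no_4cycle[of a b c d] A neq adj_sym by blast
  have "b \<noteq> f" using no_4cycle[of b c d e] A neq adj_sym by blast
  have n: "\<not> A a d" "\<not> A c f" "\<not> A b e" "\<not> A e b"
    using no_4cycle[of a b c d] no_4cycle[of c d e f] no_4cycle[of b c d e] A neq adj_sym by blast+
  have col: "colour b = (\<not> colour a)" "colour c = colour a" "colour d = (\<not> colour a)"
    "colour e = colour a" "colour f = (\<not> colour a)"
    using A[THEN adj_colour] af[THEN adj_colour] by blast+
  have V: "{a, b, c, d, e, f} \<subseteq> V" using A af adj_V adj_sym by blast
  have "pattern cycle6_mat [a, c, e] [f, b, d]"
    using V A A[THEN adj_sym] af n by (simp add: pattern_def cycle6_mat_def All_less_Suc col)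
  then show False using forbidden by blast
qed

section \<open>Exclusion of the forbidden trees\<close>

lemma no_spider2221:
  assumes A: "A r c1" "A r c2" "A r c3" "A r c4" "A c1 r1" "A c2 r2" "A c3 r3"
    and neq: "c1 \<noteq> c2" "c1 \<noteq> c3" "c1 \<noteq> c4" "c2 \<noteq> c3" "c2 \<noteq> c4" "c3 \<noteq> c4" "r \<noteq> r1" "r \<noteq> r2" "r \<noteq> r3"
  shows False
proof -
  note A' = A A[THEN adj_sym]
  \<comment> \<open>Each non-edge joins the ends of a non-backtracking walk of length 3. The trees
    below also need walks of length 5, handled by \<open>no_6cycle\<close>; hence every such tree is
    induced.\<close>
  have n: "\<not> A r1 c2" "\<not> A r1 c3" "\<not> A r1 c4" "\<not> A r2 c1" "\<not> A r2 c3" "\<not> A r2 c4"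
    "\<not> A r3 c1" "\<not> A r3 c2" "\<not> A r3 c4"
    using no_4cycle[of r1 c1 r c2] no_4cycle[of r1 c1 r c3] no_4cycle[of r1 c1 r c4]
      no_4cycle[of r2 c2 r c1] no_4cycle[of r2 c2 r c3] no_4cycle[of r2 c2 r c4]
      no_4cycle[of r3 c3 r c1] no_4cycle[of r3 c3 r c2] no_4cycle[of r3 c3 r c4]
      A' neq by simp_all
  have "pattern spider2221_mat [r, r1, r2, r3] [c1, c2, c3, c4]"
    using A' n A[THEN adj_V] A'[THEN adj_V] A[THEN adj_colour]
    by (simp add: pattern_def spider2221_mat_def All_less_Suc)
  then show False using forbidden by blast
qed

lemma no_adjacent_deg3_aux:
  assumes A: "A r c1" "A r c2" "A r c3" "A c1 r1" "A c1 r3" "A r1 c4" "A c2 r2"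
    and neq: "c1 \<noteq> c2" "c1 \<noteq> c3" "c2 \<noteq> c3" "r \<noteq> r1" "r \<noteq> r3" "r1 \<noteq> r3" "r \<noteq> r2" "c1 \<noteq> c4"
  shows False
proof -
  note A' = A A[THEN adj_sym]
  have n: "\<not> A r c4" "\<not> A r1 c2" "\<not> A r1 c3" "\<not> A r3 c2" "\<not> A r3 c3" "\<not> A r3 c4"
    "\<not> A r2 c1" "\<not> A r2 c3" "\<not> A r2 c4"
    using no_4cycle[of r c1 r1 c4] no_4cycle[of r1 c1 r c2] no_4cycle[of r1 c1 r c3]
      no_4cycle[of r3 c1 r c2] no_4cycle[of r3 c1 r c3] no_4cycle[of r3 c1 r1 c4]
      no_4cycle[of r2 c2 r c1] no_4cycle[of r2 c2 r c3] no_6cycle[of r2 c2 r c1 r1 c4]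
      A' neq by simp_all
  have "pattern adjacent_deg3_mat [r, r1, r3, r2] [c1, c2, c3, c4]"
    using A' n A[THEN adj_V] A'[THEN adj_V] A[THEN adj_colour]
    by (simp add: pattern_def adjacent_deg3_mat_def All_less_Suc)
  then show False using forbidden by blast
qed

lemma no_spider322:
  assumes A: "A r c1" "A r c2" "A r c3" "A c1 r1" "A c2 r2" "A c3 r3" "A r1 c4"
    and neq: "c1 \<noteq> c2" "c1 \<noteq> c3" "c2 \<noteq> c3" "r \<noteq> r1" "r \<noteq> r2" "r \<noteq> r3" "c1 \<noteq> c4"
  shows False
proof -
  note A' = A A[THEN adj_sym]
  have n: "\<not> A r c4" "\<not> A r1 c2" "\<not> A r1 c3" "\<not> A r2 c1" "\<not> A r2 c3" "\<not> A r2 c4"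
    "\<not> A r3 c1" "\<not> A r3 c2" "\<not> A r3 c4"
    using no_4cycle[of r c1 r1 c4] no_4cycle[of r1 c1 r c2] no_4cycle[of r1 c1 r c3]
      no_4cycle[of r2 c2 r c1] no_4cycle[of r2 c2 r c3] no_6cycle[of r2 c2 r c1 r1 c4]
      no_4cycle[of r3 c3 r c1] no_4cycle[of r3 c3 r c2] no_6cycle[of r3 c3 r c1 r1 c4]
      A' neq by simp_all
  have "pattern spider322_mat [r, r1, r2, r3] [c1, c2, c3, c4]"
    using A' n A[THEN adj_V] A'[THEN adj_V] A[THEN adj_colour]
    by (simp add: pattern_def spider322_mat_def All_less_Suc)
  then show False using forbidden by blast
qed

lemma no_distance2_deg3_aux:
  assumes A: "A r c1" "A r c2" "A r c3" "A c1 r1" "A c2 r2" "A r1 c4" "A r1 c5" "A c4 r4"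
    and neq: "c1 \<noteq> c2" "c1 \<noteq> c3" "c2 \<noteq> c3" "r \<noteq> r1" "r \<noteq> r2" "c1 \<noteq> c4" "c1 \<noteq> c5" "c4 \<noteq> c5" "r1 \<noteq> r4"
  shows False
proof -
  note A' = A A[THEN adj_sym]
  have n: "\<not> A r c4" "\<not> A r c5" "\<not> A r1 c2" "\<not> A r1 c3" "\<not> A r2 c1" "\<not> A r2 c3"
    "\<not> A r2 c4" "\<not> A r2 c5" "\<not> A r4 c1" "\<not> A r4 c2" "\<not> A r4 c3" "\<not> A r4 c5"
    using no_4cycle[of r c1 r1 c4] no_4cycle[of r c1 r1 c5] no_4cycle[of r1 c1 r c2]
      no_4cycle[of r1 c1 r c3] no_4cycle[of r2 c2 r c1] no_4cycle[of r2 c2 r c3]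
      no_6cycle[of r2 c2 r c1 r1 c4] no_6cycle[of r2 c2 r c1 r1 c5] no_4cycle[of r4 c4 r1 c1]
      no_6cycle[of r4 c4 r1 c1 r c2] no_6cycle[of r4 c4 r1 c1 r c3] no_4cycle[of r4 c4 r1 c5]
      A' neq by simp_all
  have "pattern distance2_deg3_mat [r, r1, r2, r4] [c1, c2, c3, c4, c5]"
    using A' n A[THEN adj_V] A'[THEN adj_V] A[THEN adj_colour]
    by (simp add: pattern_def distance2_deg3_mat_def All_less_Suc)
  then show False using forbidden by blast
qed

lemma no_spider421:
  assumes A: "A r c1" "A r c2" "A r c3" "A c1 r1" "A c2 r2" "A r1 c4" "A c4 r4"
    and neq: "c1 \<noteq> c2" "c1 \<noteq> c3" "c2 \<noteq> c3" "r \<noteq> r1" "r \<noteq> r2" "c1 \<noteq> c4" "r1 \<noteq> r4"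
  shows False
proof -
  note A' = A A[THEN adj_sym]
  have n: "\<not> A r c4" "\<not> A r1 c2" "\<not> A r1 c3" "\<not> A r2 c1" "\<not> A r2 c3" "\<not> A r2 c4"
    "\<not> A r4 c1" "\<not> A r4 c2" "\<not> A r4 c3"
    using no_4cycle[of r c1 r1 c4] no_4cycle[of r1 c1 r c2] no_4cycle[of r1 c1 r c3]
      no_4cycle[of r2 c2 r c1] no_4cycle[of r2 c2 r c3] no_6cycle[of r2 c2 r c1 r1 c4]
      no_4cycle[of r4 c4 r1 c1] no_6cycle[of r4 c4 r1 c1 r c2] no_6cycle[of r4 c4 r1 c1 r c3]
      A' neq by simp_all
  have "pattern spider421_mat [r, r1, r2, r4] [c1, c2, c3, c4]"
    using A' n A[THEN adj_V] A'[THEN adj_V] A[THEN adj_colour]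
    by (simp add: pattern_def spider421_mat_def All_less_Suc)
  then show False using forbidden by blast
qed

section \<open>Degree restrictions\<close>

lemma one_leaf:
  assumes "A r c" "A r c'" "c \<noteq> c'"
  shows "(\<exists>x. A c x \<and> x \<noteq> r) \<or> (\<exists>x. A c' x \<and> x \<noteq> r)"
proof (rule ccontr)
  assume "\<not> ?thesis"
  \<comment> \<open>Two leaves attached to the same vertex would be twins.\<close>
  then have "A c w \<longleftrightarrow> A c' w" for w using assms adj_sym by metis
  moreover have "colour c = colour c'" using assms(1,2)[THEN adj_colour] by blast
  ultimately show False using twins[of c c'] assms adj_V by blast
qed

text \<open>At most one of the four neighbours is a leaf, so the other three extend to legs of
  length 2.\<close>

lemma no_deg4:
  assumes "A r c1" "A r c2" "A r c3" "A r c4" "distinct [c1, c2, c3, c4]"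
  shows False
proof -
  define P where "P c \<longleftrightarrow> (\<exists>x. A c x \<and> x \<noteq> r)" for c
  have S: "\<not> (P a \<and> P b \<and> P c)" if "A r a" "A r b" "A r c" "A r d" "distinct [a, b, c, d]" for a b c d
    using no_spider2221[of r a b c d] that unfolding P_def by fastforce
  have "P a \<or> P b" if "A r a" "A r b" "a \<noteq> b" for a b
    using one_leaf[OF that] unfolding P_def .
  note L = this[of c1 c2] this[of c1 c3] this[of c1 c4] this[of c2 c3] this[of c2 c4] this[of c3 c4]
  show False
    using assms L S[of c1 c2 c3 c4] S[of c1 c2 c4 c3] S[of c1 c3 c4 c2] S[of c2 c3 c4 c1] by auto
qed

text \<open>By \<open>one_leaf\<close>, each end of the edge has a further neighbour that is not a
  leaf. The four instances of \<open>S\<close> choose this neighbour at both ends.\<close>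

lemma no_adjacent_deg3:
  assumes "A r c1" "A r c2" "A r c3" "distinct [c1, c2, c3]"
    and "A c1 r1" "A c1 r2" "distinct [r, r1, r2]"
  shows False
proof -
  have S: "\<not> ((\<exists>x. A b x \<and> x \<noteq> r) \<and> (\<exists>y. A s y \<and> y \<noteq> c1))"
    if "A r b" "A r c" "distinct [c1, b, c]" "A c1 s" "A c1 t" "distinct [r, s, t]" for b c s t
    using no_adjacent_deg3_aux[of r c1 b c s t] assms(1) that by fastforce
  show False
    using one_leaf[of r c2 c3] one_leaf[of c1 r1 r2] assms
      S[of c2 c3 r1 r2] S[of c3 c2 r1 r2] S[of c2 c3 r2 r1] S[of c3 c2 r2 r1] by auto
qed

text \<open>The leg through \<open>c2\<close> is given; \<open>one_leaf\<close> at \<open>r1\<close>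
  supplies the corresponding leg through \<open>c4\<close> or \<open>c5\<close>.\<close>

lemma no_distance2_deg3:
  assumes "A r c1" "A r c2" "A r c3" "distinct [c1, c2, c3]" "A c1 r1" "r1 \<noteq> r" "A c2 r2" "r2 \<noteq> r"
    and "A r1 c4" "A r1 c5" "distinct [c1, c4, c5]"
  shows False
proof -
  have S: "\<not> (\<exists>x. A d x \<and> x \<noteq> r1)" if "A r1 d" "A r1 e" "distinct [c1, d, e]" for d e
    using no_distance2_deg3_aux[of r c1 c2 c3 r1 r2 d e] assms that by fastforce
  show False
    using one_leaf[of r1 c4 c5] assms S[of c4 c5] S[of c5 c4] by auto
qed

lemma classifyI:
  "pattern M rs cs \<Longrightarrow> V = set rs \<union> set cs \<Longrightarrow> M \<in> S \<Longrightarrow>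
    \<exists>M rs cs. M \<in> S \<and> pattern M rs cs \<and> V = set rs \<union> set cs"
  by blast

section \<open>Graphs with a vertex of degree three\<close>

lemma spider222:
  assumes A: "A r c1" "A r c2" "A r c3" "A c1 r1" "A c2 r2" "A c3 r3"
    and neq: "distinct [c1, c2, c3]" "r1 \<noteq> r" "r2 \<noteq> r" "r3 \<noteq> r"
  shows "pattern [[1,1,0,0],[1,0,1,0],[1,0,0,1]] [c1, c2, c3] [r, r1, r2, r3]"
    and "V = {c1, c2, c3, r, r1, r2, r3}"
proof -
  note A' = A A[THEN adj_sym]
  have n: "\<not> A c1 r2" "\<not> A c1 r3" "\<not> A c2 r1" "\<not> A c2 r3" "\<not> A c3 r1" "\<not> A c3 r2"
    using no_4cycle[of c1 r c2 r2] no_4cycle[of c1 r c3 r3] no_4cycle[of c2 r c1 r1]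
      no_4cycle[of c2 r c3 r3] no_4cycle[of c3 r c1 r1] no_4cycle[of c3 r c2 r2] A' neq by auto
  show "pattern [[1,1,0,0],[1,0,1,0],[1,0,0,1]] [c1, c2, c3] [r, r1, r2, r3]"
    using A' n A[THEN adj_V] A'[THEN adj_V] A[THEN adj_colour]
    by (simp add: pattern_def All_less_Suc)
  \<comment> \<open>No vertex of the spider has a further neighbour: one at the centre gives degree
    4, one at some \<open>ci\<close> gives adjacent vertices of degree 3, and one at some
    \<open>ri\<close> gives a leg of length 3.\<close>
  have r: "y \<in> {c1, c2, c3}" if "A r y" for y
    using no_deg4[of r c1 c2 c3 y] A neq that by auto
  have c1: "y \<in> {r, r1}" if "A c1 y" for y
    using no_adjacent_deg3[of r c1 c2 c3 r1 y] A neq that by auto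
  have c2: "y \<in> {r, r2}" if "A c2 y" for y
    using no_adjacent_deg3[of r c2 c1 c3 r2 y] A neq that by auto
  have c3: "y \<in> {r, r3}" if "A c3 y" for y
    using no_adjacent_deg3[of r c3 c1 c2 r3 y] A neq that by auto
  have r1: "y = c1" if "A r1 y" for y
    using no_spider322[of r c1 c2 c3 r1 r2 r3 y] A neq that by auto
  have r2: "y = c2" if "A r2 y" for y
    using no_spider322[of r c2 c1 c3 r2 r1 r3 y] A neq that by auto
  have r3: "y = c3" if "A r3 y" for y
    using no_spider322[of r c3 c1 c2 r3 r1 r2 y] A neq that by auto
  show "V = {c1, c2, c3, r, r1, r2, r3}"
  proof (rule closed_eq_V[of r])
    show "{c1, c2, c3, r, r1, r2, r3} \<subseteq> V" using A'[THEN adj_V] by simp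
    fix x y assume "x \<in> {c1, c2, c3, r, r1, r2, r3}" "A x y"
    then show "y \<in> {c1, c2, c3, r, r1, r2, r3}"
      using r[of y] c1[of y] c2[of y] c3[of y] r1[of y] r2[of y] r3[of y] by auto
  qed simp
qed

text \<open>A leg through \<open>r1\<close> has length 2 or 3: branching at \<open>r1\<close> is
  excluded by \<open>no_distance2_deg3\<close>, and continuing beyond \<open>c4\<close> would
  produce the spider with legs 4, 2, 1.\<close>

lemma leg_end:
  assumes A: "A r c1" "A r c2" "A r c3" "A c1 r1" "A c2 r2"
    and neq: "distinct [c1, c2, c3]" "r1 \<noteq> r" "r2 \<noteq> r"
  shows "(\<forall>y. A r1 y \<longrightarrow> y = c1) \<or>
    (\<exists>c4. c4 \<noteq> c1 \<and> A r1 c4 \<and> (\<forall>y. A r1 y \<longrightarrow> y = c1 \<or> y = c4) \<and> (\<forall>y. A c4 y \<longrightarrow> y = r1))"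
proof (cases "\<forall>y. A r1 y \<longrightarrow> y = c1")
  case False
  then obtain c4 where c4: "A r1 c4" "c4 \<noteq> c1" by blast
  have "y = c1 \<or> y = c4" if "A r1 y" for y
    using no_distance2_deg3[of r c1 c2 c3 r1 r2 c4 y] A neq c4 that by auto
  moreover have "y = r1" if "A c4 y" for y
    using no_spider421[of r c1 c2 c3 r1 r2 c4 y] A neq c4 that by auto
  ultimately show ?thesis using c4 by blast
qed simp

text \<open>The leg through \<open>c3\<close> has length 1 and \<open>leg_end\<close> gives the two
  others length 2 or 3. The four combinations yield three graphs, the two mixed ones being mirror
  images.\<close>

lemma spider331:
  assumes A: "A r c1" "A r c2" "A r c3" "A c1 r1" "A c2 r2"
    and neq: "distinct [c1, c2, c3]" "r1 \<noteq> r" "r2 \<noteq> r"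
    and leaf: "\<And>y. A c3 y \<Longrightarrow> y = r"
  shows "\<exists>M rs cs. M \<in> {[[1,0,0],[1,1,1],[0,0,1]], [[1,0,0,1],[1,1,1,0],[0,0,1,0]],
      [[1,0,0,1,0],[1,1,1,0,0],[0,0,1,0,1]]} \<and> pattern M rs cs \<and> V = set rs \<union> set cs"
proof -
  note A' = A A[THEN adj_sym]
  have n: "\<not> A r1 c2" "\<not> A r1 c3" "\<not> A r2 c1" "\<not> A r2 c3"
    using no_4cycle[of r1 c1 r c2] no_4cycle[of r1 c1 r c3] no_4cycle[of r2 c2 r c1]
      no_4cycle[of r2 c2 r c3] A' neq by auto
  have r: "y \<in> {c1, c2, c3}" if "A r y" for y
    using no_deg4[of r c1 c2 c3 y] A neq that by auto
  have c1: "y \<in> {r, r1}" if "A c1 y" for y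
    using no_adjacent_deg3[of r c1 c2 c3 r1 y] A neq that by auto
  have c2: "y \<in> {r, r2}" if "A c2 y" for y
    using no_adjacent_deg3[of r c2 c1 c3 r2 y] A neq that by auto
  have V: "{r, r1, r2, c1, c2, c3} \<subseteq> V" using A'[THEN adj_V] by simp
  note colours = A[THEN adj_colour]
  have short: ?thesis if r1: "\<And>y. A r1 y \<Longrightarrow> y = c1" and r2: "\<And>y. A r2 y \<Longrightarrow> y = c2"
  proof -
    have "pattern [[1,0,0],[1,1,1],[0,0,1]] [r1, r, r2] [c1, c3, c2]"
      using A' n V colours by (simp add: pattern_def All_less_Suc)
    moreover have "V = set [r1, r, r2] \<union> set [c1, c3, c2]"
    proof (rule closed_eq_V[of r])
      fix x y assume "x \<in> set [r1, r, r2] \<union> set [c1, c3, c2]" "A x y"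
      then show "y \<in> set [r1, r, r2] \<union> set [c1, c3, c2]"
        using r[of y] c1[of y] c2[of y] leaf[of y] r1[of y] r2[of y] by auto
    qed (use V in auto)
    ultimately show ?thesis by blast
  qed
  have middle: ?thesis
    if A1: "A s1 d1" "A s2 d2" "A s1 d4" "d4 \<noteq> d1" "{s1, s2} = {r1, r2}" "{d1, d2} = {c1, c2}"
      and s1: "\<And>y. A s1 y \<Longrightarrow> y = d1 \<or> y = d4" and d4: "\<And>y. A d4 y \<Longrightarrow> y = s1"
      and s2: "\<And>y. A s2 y \<Longrightarrow> y = d2" for s1 s2 d1 d2 d4
  proof -
    \<comment> \<open>The names \<open>s\<close> and \<open>d\<close> allow either leg to be the
      long one; the non-edges \<open>n\<close> force rows and columns to be exchanged
      together.\<close>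
    have "s1 = r1 \<and> s2 = r2 \<or> s1 = r2 \<and> s2 = r1" using A1(5) by (auto simp: doubleton_eq_iff)
    then have sd: "s1 = r1 \<and> s2 = r2 \<and> d1 = c1 \<and> d2 = c2 \<or> s1 = r2 \<and> s2 = r1 \<and> d1 = c2 \<and> d2 = c1"
      using A1 n by (auto simp: doubleton_eq_iff)
    have n4: "\<not> A r d4" "\<not> A s2 d4"
      using d4[of r] d4[of s2] A' A1(1,2) sd n neq adj_sym by blast+
    have "pattern [[1,0,0,1],[1,1,1,0],[0,0,1,0]] [s1, r, s2] [d1, c3, d2, d4]"
      using sd A' n n4 V colours A1(3) A1(3)[THEN adj_V] A1(3)[THEN adj_colour]
      by (elim disjE) (simp_all add: pattern_def All_less_Suc)
    moreover have "V = set [s1, r, s2] \<union> set [d1, c3, d2, d4]"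
    proof (rule closed_eq_V[of r])
      fix x y assume "x \<in> set [s1, r, s2] \<union> set [d1, c3, d2, d4]" "A x y"
      then show "y \<in> set [s1, r, s2] \<union> set [d1, c3, d2, d4]"
        using sd r[of y] c1[of y] c2[of y] leaf[of y] s1[of y] s2[of y] d4[of y] by auto
    qed (use V sd A1(3)[THEN adj_V] in auto)
    ultimately show ?thesis by blast
  qed
  have long: ?thesis
    if c4: "c4 \<noteq> c1" "A r1 c4" and r1: "\<And>y. A r1 y \<Longrightarrow> y = c1 \<or> y = c4"
      and c4': "\<And>y. A c4 y \<Longrightarrow> y = r1"
      and c5: "c5 \<noteq> c2" "A r2 c5" and r2: "\<And>y. A r2 y \<Longrightarrow> y = c2 \<or> y = c5"
      and c5': "\<And>y. A c5 y \<Longrightarrow> y = r2" for c4 c5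
  proof -
    have "r1 \<noteq> r2" using A' n by blast
    then have n4: "\<not> A r c4" "\<not> A r2 c4" "\<not> A r c5" "\<not> A r1 c5"
      using c4' c5' neq adj_sym by blast+
    have "pattern [[1,0,0,1,0],[1,1,1,0,0],[0,0,1,0,1]] [r1, r, r2] [c1, c3, c2, c4, c5]"
      using A' n n4 V colours c4(2) c5(2) c4(2)[THEN adj_V] c5(2)[THEN adj_V]
        c4(2)[THEN adj_colour] c5(2)[THEN adj_colour]
      by (simp add: pattern_def All_less_Suc)
    moreover have "V = set [r1, r, r2] \<union> set [c1, c3, c2, c4, c5]"
    proof (rule closed_eq_V[of r])
      fix x y assume "x \<in> set [r1, r, r2] \<union> set [c1, c3, c2, c4, c5]" "A x y"
      then show "y \<in> set [r1, r, r2] \<union> set [c1, c3, c2, c4, c5]"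
        using r[of y] c1[of y] c2[of y] leaf[of y] r1[of y] r2[of y] c4'[of y] c5'[of y] by auto
    qed (use V c4(2)[THEN adj_V] c5(2)[THEN adj_V] in auto)
    ultimately show ?thesis by blast
  qed
  have "(\<forall>y. A r1 y \<longrightarrow> y = c1) \<or>
    (\<exists>c4. c4 \<noteq> c1 \<and> A r1 c4 \<and> (\<forall>y. A r1 y \<longrightarrow> y = c1 \<or> y = c4) \<and> (\<forall>y. A c4 y \<longrightarrow> y = r1))"
    by (rule leg_end[of r c1 c2 c3 r1 r2]) (use A neq in auto)
  moreover have "(\<forall>y. A r2 y \<longrightarrow> y = c2) \<or>
    (\<exists>c4. c4 \<noteq> c2 \<and> A r2 c4 \<and> (\<forall>y. A r2 y \<longrightarrow> y = c2 \<or> y = c4) \<and> (\<forall>y. A c4 y \<longrightarrow> y = r2))"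
    by (rule leg_end[of r c2 c1 c3 r2 r1]) (use A neq in auto)
  ultimately show ?thesis
  proof (elim disjE exE conjE)
    assume "\<forall>y. A r1 y \<longrightarrow> y = c1" "\<forall>y. A r2 y \<longrightarrow> y = c2"
    then show ?thesis by (intro short) blast+
  next
    fix c4 assume "\<forall>y. A r1 y \<longrightarrow> y = c1" "c4 \<noteq> c2" "A r2 c4"
      "\<forall>y. A r2 y \<longrightarrow> y = c2 \<or> y = c4" "\<forall>y. A c4 y \<longrightarrow> y = r2"
    then show ?thesis using A' by (intro middle[of r2 c2 r1 c1 c4]) blast+
  next
    fix c4 assume "\<forall>y. A r2 y \<longrightarrow> y = c2" "c4 \<noteq> c1" "A r1 c4"
      "\<forall>y. A r1 y \<longrightarrow> y = c1 \<or> y = c4" "\<forall>y. A c4 y \<longrightarrow> y = r1"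
    then show ?thesis using A' by (intro middle[of r1 c1 r2 c2 c4]) blast+
  next
    fix c4 c5 assume "c4 \<noteq> c1" "A r1 c4" "\<forall>y. A r1 y \<longrightarrow> y = c1 \<or> y = c4" "\<forall>y. A c4 y \<longrightarrow> y = r1"
      "c5 \<noteq> c2" "A r2 c5" "\<forall>y. A r2 y \<longrightarrow> y = c2 \<or> y = c5" "\<forall>y. A c5 y \<longrightarrow> y = r2"
    then show ?thesis by (intro long[of c4 c5]) blast+
  qed
qed

text \<open>By \<open>one_leaf\<close> at least two of the three neighbours extend: three give
  \<open>spider222\<close>, exactly two give \<open>spider331\<close> after a permutation.\<close>

lemma classify_deg3:
  assumes A: "A r c1" "A r c2" "A r c3" and neq: "distinct [c1, c2, c3]"
  shows "\<exists>M rs cs. M \<in> spider_mats \<and>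
    pattern M rs cs \<and> V = set rs \<union> set cs"
proof -
  define P where "P c \<longleftrightarrow> (\<exists>x. A c x \<and> x \<noteq> r)" for c
  have *: ?thesis if abc: "A r a" "A r b" "A r c" "distinct [a, b, c]" "P a" "P b" "\<not> P c" for a b c
  proof -
    obtain x y where "A a x" "x \<noteq> r" "A b y" "y \<noteq> r" using abc by (auto simp: P_def)
    then show ?thesis
      using spider331[of r a b c x y] abc unfolding P_def by blast
  qed
  consider "P c1" "P c2" "P c3" | "P c1" "P c2" "\<not> P c3" | "P c1" "P c3" "\<not> P c2" | "P c2" "P c3" "\<not> P c1"
    using one_leaf[of r c1 c2] one_leaf[of r c1 c3] one_leaf[of r c2 c3] A neq
    unfolding P_def[symmetric] by auto
  then show ?thesis
  proof cases
    case 1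
    then obtain r1 r2 r3 where r: "A c1 r1" "A c2 r2" "A c3 r3" "r1 \<noteq> r" "r2 \<noteq> r" "r3 \<noteq> r"
      by (auto simp: P_def)
    show ?thesis
      using A neq r by (intro classifyI[OF spider222(1)[of r c1 c2 c3 r1 r2 r3]])
        (simp_all add: spider222(2)[of r c1 c2 c3 r1 r2 r3] insert_commute)
  qed (use *[of c1 c2 c3] *[of c1 c3 c2] *[of c2 c3 c1] A neq in auto)
qed

section \<open>Induced paths\<close>

definition ipath :: "'v list \<Rightarrow> bool" where
  "ipath p \<longleftrightarrow> distinct p \<and> set p \<subseteq> V \<and>
     (\<forall>i<length p. \<forall>j<length p. A (p ! i) (p ! j) \<longleftrightarrow> i = Suc j \<or> j = Suc i)"

lemma ipath_adj: "ipath p \<Longrightarrow> i < length p \<Longrightarrow> j < length p \<Longrightarrow> A (p ! i) (p ! j) \<longleftrightarrow> i = Suc j \<or> j = Suc i"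
  by (simp add: ipath_def)

lemma ipath_colour:
  assumes "ipath p" "i < length p"
  shows "colour (p ! i) = (if even i then colour (p ! 0) else \<not> colour (p ! 0))"
  using assms(2)
proof (induction i)
  case (Suc i)
  then have "A (p ! i) (p ! Suc i)" using ipath_adj[OF assms(1)] by simp
  then show ?case using Suc adj_colour by auto
qed simp

lemma ipath_rev: "ipath p \<Longrightarrow> ipath (rev p)"
  unfolding ipath_def by (auto simp: rev_nth)

lemma ipath_length:
  assumes "ipath p"
  shows "length p < 10"
proof (rule ccontr)
  assume n: "\<not> ?thesis"
  have V: "p ! i \<in> V" if "i < 10" for i
    using assms n that by (auto simp: ipath_def subset_iff)
  have adj: "A (p ! i) (p ! j) \<longleftrightarrow> i = Suc j \<or> j = Suc i" if "i < 10" "j < 10" for i j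
    using n that by (intro ipath_adj[OF assms]) auto
  have colour: "colour (p ! i) = (if even i then colour (p ! 0) else \<not> colour (p ! 0))"
    if "0 < i" "i < 10" for i
    using n that by (intro ipath_colour[OF assms]) auto
  \<comment> \<open>The first ten vertices already form the forbidden path; odd positions serve as
    rows.\<close>
  have "pattern path10_mat [p ! 1, p ! 3, p ! 5, p ! 7, p ! 9] [p ! 0, p ! 2, p ! 4, p ! 6, p ! 8]"
    by (simp add: pattern_def path10_mat_def All_less_Suc V adj colour)
  then show False using forbidden by blast
qed

lemma set_conv_nth_upto: "set p = (\<lambda>i. p ! i) ` {..<length p}"
  by (auto simp: set_conv_nth)

section \<open>Graphs of maximum degree two\<close>

context
  assumes deg2: "\<And>v a b c. A v a \<Longrightarrow> A v b \<Longrightarrow> A v c \<Longrightarrow> \<not> distinct [a, b, c]"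
begin

lemma ipath_inner_neighbours:
  assumes p: "ipath p" and i: "0 < i" "Suc i < length p" and w: "A (p ! i) w"
  shows "w \<in> set p"
proof -
  have "A (p ! i) (p ! (i - 1))" "A (p ! i) (p ! Suc i)"
    using p i by (simp_all add: ipath_adj)
  moreover have "p ! (i - 1) \<noteq> p ! Suc i"
    using p i by (simp add: ipath_def nth_eq_iff_index_eq)
  ultimately have "w = p ! (i - 1) \<or> w = p ! Suc i"
    using deg2[of "p ! i" "p ! (i - 1)" "p ! Suc i" w] w by auto
  then show ?thesis using i by auto
qed

text \<open>Inner vertices already have two neighbours on the path, so a new vertex can meet only
  its ends; excluding the far end keeps the longer path induced.\<close>

lemma ipath_Cons:
  assumes p: "ipath p" and n: "2 \<le> length p" and w: "A w (p ! 0)" "w \<notin> set p"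
    and last: "\<not> A w (p ! (length p - 1))"
  shows "ipath (w # p)"
proof -
  have wi: "A w (p ! i) \<longleftrightarrow> i = 0" if i: "i < length p" for i
  proof (cases "i = 0 \<or> i = length p - 1")
    case True
    then show ?thesis using w last n by auto
  next
    case False
    then have "0 < i" "Suc i < length p" using i by auto
    then show ?thesis
      using ipath_inner_neighbours[OF p, of i w] False w(2) adj_sym by blast
  qed
  have iw: "A (p ! i) w \<longleftrightarrow> i = 0" if "i < length p" for i
    using wi[OF that] adj_sym by blast
  have ww: "\<not> A w w" using adj_colour by blast
  have "A ((w # p) ! i) ((w # p) ! j) \<longleftrightarrow> i = Suc j \<or> j = Suc i"
    if "i < length (w # p)" "j < length (w # p)" for i j
    using that by (cases i; cases j) (simp_all add: wi iw ww ipath_adj[OF p])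
  moreover have "w \<in> V" using w adj_sym adj_V by blast
  ultimately show ?thesis using p w(2) by (auto simp: ipath_def)
qed

lemma path_or_cycle:
  obtains p where "ipath p" "2 \<le> length p" "V = set p"
  | p w where "ipath p" "2 \<le> length p" "w \<notin> set p" "A w (p ! 0)" "A w (p ! (length p - 1))"
      "V = insert w (set p)"
proof -
  obtain u v where uv: "A u v" using edge_exists by blast
  have uv': "u \<noteq> v" "\<not> A u u" "\<not> A v v" "A v u" "u \<in> V" "v \<in> V"
    using uv adj_colour adj_sym adj_V by blast+
  have "ipath [u, v]" using uv uv' by (auto simp: ipath_def All_less_Suc)
  then have ex: "\<exists>p. ipath p \<and> 2 \<le> length p" by (intro exI[of _ "[u, v]"]) simp
  \<comment> \<open>A longest induced path exists because \<open>ipath_length\<close> bounds all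
    lengths, even in an infinite graph.\<close>
  obtain p where p: "ipath p" "2 \<le> length p" and max: "\<And>q. ipath q \<Longrightarrow> 2 \<le> length q \<Longrightarrow> length q \<le> length p"
    using ex_has_greatest_nat[where P = "\<lambda>p. ipath p \<and> 2 \<le> length p" and f = length and b = 10]
      ex ipath_length by (metis less_imp_le_nat)
  \<comment> \<open>By maximality, an outside neighbour of the first vertex must also see the last
    one; otherwise it could be prepended.\<close>
  have extend: "A w (q ! (length q - 1))"
    if "ipath q" "length q = length p" "A w (q ! 0)" "w \<notin> set q" for q w
    using ipath_Cons[OF that(1) _ that(3,4)] max[of "w # q"] that(2) p(2) by fastforce
  show thesis
  proof (cases "\<exists>w. A w (p ! 0) \<and> w \<notin> set p")
    case True
    then obtain w where w: "A w (p ! 0)" "w \<notin> set p" by blast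
    have wl: "A w (p ! (length p - 1))" using extend[OF p(1) _ w] by simp
    \<comment> \<open>The vertex \<open>w\<close>, the inner vertices and the two ends all have two
      known neighbours, so this set is closed under adjacency.\<close>
    have "V = insert w (set p)"
    proof (rule closed_eq_V[of w])
      show "insert w (set p) \<subseteq> V" using p w(1)[THEN adj_sym, THEN adj_V] by (auto simp: ipath_def)
      fix x y assume x: "x \<in> insert w (set p)" and xy: "A x y"
      have 3: "b \<in> {p ! 0, p ! (length p - 1)}" if "A w b" for b
      proof -
        have "p ! 0 \<noteq> p ! (length p - 1)"
          using p by (subst nth_eq_iff_index_eq) (auto simp: ipath_def)
        then show ?thesis using deg2[of w "p ! 0" "p ! (length p - 1)" b] w wl that by auto
      qed
      show "y \<in> insert w (set p)"
      proof (cases "x = w")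
        case True
        then show ?thesis using 3[of y] xy p by (auto intro!: nth_mem)
      next
        case False
        then obtain i where i: "i < length p" "x = p ! i" using x by (auto simp: set_conv_nth)
        consider "0 < i" "Suc i < length p" | "i = 0" | "i = length p - 1" using i by linarith
        then show ?thesis
        proof cases
          case 1
          then show ?thesis using ipath_inner_neighbours[OF p(1)] i xy by blast
        next
          case 2
          have "A x (p ! 1)" "p ! 1 \<noteq> w" using p i 2 w nth_mem[of 1 p] by (auto simp: ipath_adj)
          moreover have "A x w" using w i 2 adj_sym by blast
          moreover have "p ! 1 \<in> set p" using p by (intro nth_mem) auto
          ultimately show ?thesis using deg2[of x w "p ! 1" y] xy by auto
        next
          case 3
          have "A x (p ! (length p - 2))" "p ! (length p - 2) \<noteq> w"
            using p i 3 w nth_mem[of "length p - 2" p] by (auto simp: ipath_adj)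
          moreover have "A x w" using wl i 3 adj_sym by blast
          moreover have "p ! (length p - 2) \<in> set p" using p by (intro nth_mem) auto
          ultimately show ?thesis using deg2[of x w "p ! (length p - 2)" y] xy by auto
        qed
      qed
    qed simp
    then show thesis using that(2) p w wl by blast
  next
    case False
    \<comment> \<open>Applied to the reversed path, \<open>extend\<close> would turn an outside
      neighbour of the last vertex into one of the first.\<close>
    have "w \<in> set p" if "A w (p ! (length p - 1))" for w
    proof (rule ccontr)
      assume w: "w \<notin> set p"
      have "p \<noteq> []" using p by auto
      then have "A w (p ! 0)"
        using extend[of "rev p" w] ipath_rev[OF p(1)] w that p by (simp add: rev_nth)
      then show False using False w by blast
    qed
    then have "y \<in> set p" if iy: "A (p ! i) y" "i < length p" for i y
    proof -
      consider "0 < i" "Suc i < length p" | "i = 0" | "i = length p - 1" using iy by linarith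
      then show ?thesis
        using ipath_inner_neighbours[OF p(1), of i y] iy False adj_sym
          \<open>\<And>w. A w (p ! (length p - 1)) \<Longrightarrow> w \<in> set p\<close> by cases blast+
    qed
    then have "V = set p"
      using p by (intro closed_eq_V[of "p ! 0"]) (auto simp: ipath_def set_conv_nth)
    then show thesis using that(1) p by blast
  qed
qed

lemma classify_deg2:
  "\<exists>M rs cs. M \<in> path_mats \<and>
    pattern M rs cs \<and> V = set rs \<union> set cs"
proof (cases rule: path_or_cycle)
  case (1 p)
  note p = 1
  have V: "p ! i \<in> V" if "i < length p" for i using that p(3) by simp
  have colour: "colour (p ! i) = (if even i then colour (p ! 0) else \<not> colour (p ! 0))"
    if "0 < i" "i < length p" for i
    using ipath_colour[OF p(1) that(2)] .
  note simps = pattern_def All_less_Suc V ipath_adj[OF p(1)] colour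
  have set: "V = (\<lambda>i. p ! i) ` {..<length p}" by (simp only: p(3) set_conv_nth_upto)
  have "length p < 10" using ipath_length p by blast
  then consider "length p = 2" | "length p = 3" | "length p = 4" | "length p = 5" | "length p = 6"
    | "length p = 7" | "length p = 8" | "length p = 9" using p(2) by linarith
  then show ?thesis
  proof cases
    case 1
    have "pattern [[1]] [p ! 0] [p ! 1]"
      using 1 by (simp add: simps)
    moreover have "V = set [p ! 0] \<union> set [p ! 1]"
      using 1 by (simp add: set lessThan_Suc numeral_eq_Suc insert_commute)
    ultimately show ?thesis by (rule classifyI) simp
  next
    case 2
    \<comment> \<open>The path on three vertices is the one length that drops out, since its two
      ends are twins.\<close>
    have "p ! 0 = p ! 2"
    proof (rule twins)
      fix w
      show "A (p ! 0) w \<longleftrightarrow> A (p ! 2) w"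
      proof (cases "w \<in> V")
        case True
        then show ?thesis using 2 unfolding set by (auto simp: ipath_adj[OF p(1)])
      next
        case False
        then show ?thesis using adj_V by blast
      qed
    qed (use 2 V ipath_colour[OF p(1), of 2] in simp_all)
    then have False using p(1) 2 by (simp add: ipath_def nth_eq_iff_index_eq)
    then show ?thesis ..
  next
    case 3
    \<comment> \<open>Taking odd positions as rows and even positions as columns makes the matrix
      bidiagonal, here and for all longer paths.\<close>
    have "pattern [[1,1],[0,1]] [p ! 1, p ! 3] [p ! 0, p ! 2]"
      using 3 by (simp add: simps)
    moreover have "V = set [p ! 1, p ! 3] \<union> set [p ! 0, p ! 2]"
      using 3 by (simp add: set lessThan_Suc numeral_eq_Suc insert_commute)
    ultimately show ?thesis by (rule classifyI) simp
  next
    case 4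
    have "pattern [[1,1,0],[0,1,1]] [p ! 1, p ! 3] [p ! 0, p ! 2, p ! 4]"
      using 4 by (simp add: simps)
    moreover have "V = set [p ! 1, p ! 3] \<union> set [p ! 0, p ! 2, p ! 4]"
      using 4 by (simp add: set lessThan_Suc numeral_eq_Suc insert_commute)
    ultimately show ?thesis by (rule classifyI) simp
  next
    case 5
    have "pattern [[1,1,0],[0,1,1],[0,0,1]] [p ! 1, p ! 3, p ! 5] [p ! 0, p ! 2, p ! 4]"
      using 5 by (simp add: simps)
    moreover have "V = set [p ! 1, p ! 3, p ! 5] \<union> set [p ! 0, p ! 2, p ! 4]"
      using 5 by (simp add: set lessThan_Suc numeral_eq_Suc insert_commute)
    ultimately show ?thesis by (rule classifyI) simp
  next
    case 6
    have "pattern [[1,1,0,0],[0,1,1,0],[0,0,1,1]] [p ! 1, p ! 3, p ! 5] [p ! 0, p ! 2, p ! 4, p ! 6]"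
      using 6 by (simp add: simps)
    moreover have "V = set [p ! 1, p ! 3, p ! 5] \<union> set [p ! 0, p ! 2, p ! 4, p ! 6]"
      using 6 by (simp add: set lessThan_Suc numeral_eq_Suc insert_commute)
    ultimately show ?thesis by (rule classifyI) simp
  next
    case 7
    have "pattern [[1,1,0,0],[0,1,1,0],[0,0,1,1],[0,0,0,1]] [p ! 1, p ! 3, p ! 5, p ! 7] [p ! 0, p ! 2, p ! 4, p ! 6]"
      using 7 by (simp add: simps)
    moreover have "V = set [p ! 1, p ! 3, p ! 5, p ! 7] \<union> set [p ! 0, p ! 2, p ! 4, p ! 6]"
      using 7 by (simp add: set lessThan_Suc numeral_eq_Suc insert_commute)
    ultimately show ?thesis by (rule classifyI) simp
  next
    case 8
    have "pattern [[1,1,0,0,0],[0,1,1,0,0],[0,0,1,1,0],[0,0,0,1,1]] [p ! 1, p ! 3, p ! 5, p ! 7] [p ! 0, p ! 2, p ! 4, p ! 6, p ! 8]"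
      using 8 by (simp add: simps)
    moreover have "V = set [p ! 1, p ! 3, p ! 5, p ! 7] \<union> set [p ! 0, p ! 2, p ! 4, p ! 6, p ! 8]"
      using 8 by (simp add: set lessThan_Suc numeral_eq_Suc insert_commute)
    ultimately show ?thesis by (rule classifyI) simp
  qed
next
  case (2 p w)
  note p = 2
  have V: "p ! i \<in> V" if "i < length p" for i using that p(6) by simp
  have w: "w \<in> V" using p by simp
  have wi: "A w (p ! i) \<longleftrightarrow> i = 0 \<or> i = length p - 1" if "i < length p" for i
  proof (cases "i = 0 \<or> i = length p - 1")
    case False
    then have "0 < i" "Suc i < length p" using that by auto
    then show ?thesis using ipath_inner_neighbours[OF p(1), of i w] False p(3) adj_sym by blast
  qed (use p in auto)
  \<comment> \<open>Both ends are adjacent to \<open>w\<close>, hence of equal colour. The cycle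
    through \<open>w\<close> therefore has 4, 6, 8 or 10 vertices, and only the 8-cycle
    survives.\<close>
  have odd: "odd (length p)"
    using ipath_colour[OF p(1), of "length p - 1"] p(2) adj_colour[OF p(4)] adj_colour[OF p(5)]
    by (auto split: if_splits)
  have neq1: "w \<noteq> p ! i" if "i < length p" for i
    using that p(3) by auto
  have neq2: "p ! i \<noteq> p ! j" if "i < length p" "j < length p" "i \<noteq> j" for i j
    using that p(1) by (auto simp: ipath_def nth_eq_iff_index_eq)
  note neq = neq1 neq2
  have colw: "colour w = (\<not> colour (p ! 0))" using adj_colour[OF p(4)] by blast
  have colour: "colour (p ! i) = (if even i then colour (p ! 0) else \<not> colour (p ! 0))"
    if "0 < i" "i < length p" for i
    using ipath_colour[OF p(1) that(2)] .
  note simps = pattern_def All_less_Suc V w ipath_adj[OF p(1)] colour wi colw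
  have set: "V = insert w ((\<lambda>i. p ! i) ` {..<length p})" by (simp only: p(6) set_conv_nth_upto)
  have "length p < 10" using ipath_length p by blast
  then have "length p = 2 \<or> length p = 3 \<or> length p = 4 \<or> length p = 5 \<or> length p = 6 \<or>
      length p = 7 \<or> length p = 8 \<or> length p = 9" using p(2) by linarith
  then consider "length p = 3" | "length p = 5" | "length p = 7" | "length p = 9"
    using odd by (elim disjE) simp_all
  then show ?thesis
  proof cases
    case 1
    have "\<not> A w (p ! 2)"
      by (rule no_4cycle[of w "p ! 0" "p ! 1" "p ! 2"]) (use 1 in \<open>simp_all add: wi ipath_adj[OF p(1)] neq\<close>)
    then show ?thesis using 1 by (simp add: wi)
  next
    case 2
    have "\<not> A w (p ! 4)"
      by (rule no_6cycle[of w "p ! 0" "p ! 1" "p ! 2" "p ! 3" "p ! 4"])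
        (use 2 in \<open>simp_all add: wi ipath_adj[OF p(1)] neq\<close>)
    then show ?thesis using 2 by (simp add: wi)
  next
    case 3
    have "pattern [[1,1,0,0],[1,0,1,0],[0,1,0,1],[0,0,1,1]] [w, p ! 1, p ! 5, p ! 3] [p ! 0, p ! 6, p ! 2, p ! 4]"
      using 3 by (simp add: simps)
    moreover have "V = set [w, p ! 1, p ! 5, p ! 3] \<union> set [p ! 0, p ! 6, p ! 2, p ! 4]"
      using 3 by (simp add: set lessThan_Suc numeral_eq_Suc insert_commute)
    ultimately show ?thesis by (rule classifyI) simp
  next
    case 4
    then have "pattern cycle10_mat [p ! 1, p ! 3, p ! 5, p ! 7, w] [p ! 0, p ! 2, p ! 4, p ! 6, p ! 8]"
      by (simp add: simps cycle10_mat_def)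
    then show ?thesis using forbidden by blast
  qed
qed

end

end

section \<open>Transfer to induced subgraphs of bipartite graphs\<close>

definition embedding :: "(nat \<Rightarrow> nat) \<Rightarrow> (nat \<Rightarrow> nat) \<Rightarrow> bgraph \<Rightarrow> bgraph \<Rightarrow> bool" where
  "embedding f g H G \<longleftrightarrow> inj_on f (rows H) \<and> f ` rows H \<subseteq> rows G \<and>
     inj_on g (cols H) \<and> g ` cols H \<subseteq> cols G \<and>
     (\<forall>r\<in>rows H. \<forall>c\<in>cols H. (r, c) \<in> edges H \<longleftrightarrow> (f r, g c) \<in> edges G)"

definition embeds :: "bgraph \<Rightarrow> bgraph \<Rightarrow> bool" where
  "embeds H G \<longleftrightarrow> (\<exists>f g. embedding f g H G)"

text \<open>The side swap is absorbed into a transposition, so transitivity reduces to composing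
  embeddings, with two swaps cancelling.\<close>

lemma ind_le_iff_embeds: "ind_le H G \<longleftrightarrow> embeds H G \<or> embeds H (transpose_bg G)"
  by (simp add: ind_le_def embeds_def embedding_def)

lemma transpose_transpose_bg [simp]: "transpose_bg (transpose_bg G) = G"
  by (simp add: transpose_bg_def rows_def cols_def edges_def)

lemma embeds_transpose:
  assumes "embeds H G"
  shows "embeds (transpose_bg H) (transpose_bg G)"
proof -
  obtain f g where "embedding f g H G" using assms unfolding embeds_def by blast
  then have "embedding g f (transpose_bg H) (transpose_bg G)" by (simp add: embedding_def)
  then show ?thesis unfolding embeds_def by blast
qed

lemma embedding_comp:
  assumes 1: "embedding f g H G" and 2: "embedding f' g' G K"
  shows "embedding (f' \<circ> f) (g' \<circ> g) H K"
proof -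
  have "inj_on (f' \<circ> f) (rows H)"
    using 1 2 unfolding embedding_def by (intro comp_inj_on) (auto intro: inj_on_subset)
  moreover have "inj_on (g' \<circ> g) (cols H)"
    using 1 2 unfolding embedding_def by (intro comp_inj_on) (auto intro: inj_on_subset)
  ultimately show ?thesis
    using 1 2 by (simp add: embedding_def image_subset_iff)
qed

lemma embeds_trans: "embeds H G \<Longrightarrow> embeds G K \<Longrightarrow> embeds H K"
  unfolding embeds_def using embedding_comp by blast

lemma ind_le_trans:
  assumes "ind_le H G" "ind_le G K"
  shows "ind_le H K"
  using assms embeds_trans embeds_transpose[of G K] embeds_transpose[of G "transpose_bg K"]
  unfolding ind_le_iff_embeds transpose_transpose_bg by blast

text \<open>Indices naming the same vertex would give equal rows or columns of \<open>M\<close>, so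
  twin-freeness makes both lists injective. If the lists also exhaust \<open>G\<close>, inverting
  them embeds \<open>G\<close> back.\<close>

lemma mat_graph_embeds:
  assumes tf: "twin_free (mat_graph M)"
    and len: "length xs = length M" "length ys = length (hd M)"
    and sub: "set xs \<subseteq> rows G" "set ys \<subseteq> cols G"
    and M: "\<forall>i<length M. \<forall>j<length (hd M). (xs ! i, ys ! j) \<in> edges G \<longleftrightarrow> M ! i ! j = 1"
  shows "embeds (mat_graph M) G"
    and "rows G \<subseteq> set xs \<Longrightarrow> cols G \<subseteq> set ys \<Longrightarrow> embeds G (mat_graph M)"
proof -
  have inj: "inj_on (\<lambda>i. xs ! i) {..<length M}" "inj_on (\<lambda>j. ys ! j) {..<length (hd M)}"
  proof -
    show "inj_on (\<lambda>i. xs ! i) {..<length M}"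
    proof (rule inj_onI)
      fix i i' assume ii: "i \<in> {..<length M}" "i' \<in> {..<length M}" "xs ! i = xs ! i'"
      then have "\<forall>j<length (hd M). M ! i ! j = 1 \<longleftrightarrow> M ! i' ! j = 1"
        using M by (metis lessThan_iff)
      then show "i = i'" using tf ii by (simp add: twin_free_def)
    qed
    show "inj_on (\<lambda>j. ys ! j) {..<length (hd M)}"
    proof (rule inj_onI)
      fix j j' assume jj: "j \<in> {..<length (hd M)}" "j' \<in> {..<length (hd M)}" "ys ! j = ys ! j'"
      then have "\<forall>i<length M. M ! i ! j = 1 \<longleftrightarrow> M ! i ! j' = 1"
        using M by (metis lessThan_iff)
      then show "j = j'" using tf jj by (simp add: twin_free_def)
    qed
  qed
  show "embeds (mat_graph M) G"
    unfolding embeds_def embedding_def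
    by (rule exI[of _ "\<lambda>i. xs ! i"], rule exI[of _ "\<lambda>j. ys ! j"])
      (use inj len sub M in \<open>auto simp: subset_iff\<close>)
  assume "rows G \<subseteq> set xs" "cols G \<subseteq> set ys"
  then have bij: "bij_betw (\<lambda>i. xs ! i) {..<length M} (rows G)"
    "bij_betw (\<lambda>j. ys ! j) {..<length (hd M)} (cols G)"
    using inj sub len by (auto simp: bij_betw_def set_conv_nth)
  define f g where "f = the_inv_into {..<length M} (\<lambda>i. xs ! i)"
    and "g = the_inv_into {..<length (hd M)} (\<lambda>j. ys ! j)"
  have fg: "bij_betw f (rows G) {..<length M}" "bij_betw g (cols G) {..<length (hd M)}"
    unfolding f_def g_def using bij by (auto intro: bij_betw_the_inv_into)
  have inv: "xs ! f r = r" "ys ! g c = c" if "r \<in> rows G" "c \<in> cols G" for r c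
    using that bij by (auto simp: f_def g_def f_the_inv_into_f_bij_betw)
  have "(r, c) \<in> edges G \<longleftrightarrow> (f r, g c) \<in> edges (mat_graph M)" if rc: "r \<in> rows G" "c \<in> cols G" for r c
  proof -
    have "f r < length M" "g c < length (hd M)" using fg rc by (auto simp: bij_betw_def)
    then show ?thesis using M inv[OF rc] by (metis mat_graph_simps(3))
  qed
  note edges = this
  show "embeds G (mat_graph M)"
    unfolding embeds_def embedding_def
    by (rule exI[of _ f], rule exI[of _ g]) (use fg edges in \<open>auto simp: bij_betw_def\<close>)
qed

lemma bigraph_bipartite:
  assumes "bigraph G"
  shows "bipartite (\<lambda>u v. (u, v) \<in> adj G) isl (vertices G)"
  by unfold_locales (use assms in \<open>auto simp: adj_def vertices_def bigraph_def\<close>)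

lemma all_isl_list: "\<forall>r\<in>set rs. isl r \<Longrightarrow> \<exists>xs. rs = map Inl xs"
  by (intro exI[of _ "map projl rs"]) (simp add: map_idI)

lemma no_isl_list: "\<forall>r\<in>set rs. \<not> isl r \<Longrightarrow> \<exists>xs. rs = map Inr xs"
  by (intro exI[of _ "map projr rs"]) (simp add: map_idI)

lemma Inl_Inr_eq_vertices_iff:
  "vertices G = Inl ` X \<union> Inr ` Y \<longleftrightarrow> rows G = X \<and> cols G = Y"
  "vertices G = Inr ` Y \<union> Inl ` X \<longleftrightarrow> rows G = X \<and> cols G = Y"
  unfolding vertices_def by blast+

text \<open>The colour condition, with both lists nonempty, puts \<open>rs\<close> entirely on one
  side and \<open>cs\<close> on the other. If \<open>rs\<close> consists of columns, the argument
  runs in the transposed graph.\<close>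

lemma pattern_ind_le:
  assumes G: "bigraph G" and tf: "twin_free (mat_graph M)"
    and pat: "bipartite.pattern (\<lambda>u v. (u, v) \<in> adj G) isl (vertices G) M rs cs"
    and ne: "rs \<noteq> []" "cs \<noteq> []"
  shows "ind_le (mat_graph M) G"
    and "vertices G = set rs \<union> set cs \<Longrightarrow> ind_le G (mat_graph M)"
proof -
  note p = pat[unfolded bipartite.pattern_def[OF bigraph_bipartite[OF G]]]
  have col: "isl c = (\<not> isl r)" if "r \<in> set rs" "c \<in> set cs" for r c using p that by blast
  have hd: "hd rs \<in> set rs" "hd cs \<in> set cs" using ne by simp_all
  have "ind_le (mat_graph M) G \<and> (vertices G = set rs \<union> set cs \<longrightarrow> ind_le G (mat_graph M))"
  proof (cases "isl (hd rs)")
    case True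
    then have "\<forall>c\<in>set cs. \<not> isl c" using col hd by blast
    moreover from this have "\<forall>r\<in>set rs. isl r" using col hd by blast
    ultimately obtain xs ys where rs: "rs = map Inl xs" and cs: "cs = map Inr ys"
      using all_isl_list no_isl_list by metis
    have len: "length xs = length M" "length ys = length (hd M)" using p rs cs by simp_all
    have sub: "set xs \<subseteq> rows G" "set ys \<subseteq> cols G"
      using p unfolding rs cs vertices_def by auto
    have M: "\<forall>i<length M. \<forall>j<length (hd M). (xs ! i, ys ! j) \<in> edges G \<longleftrightarrow> M ! i ! j = 1"
      using p len by (simp add: rs cs adj_def)
    note emb = mat_graph_embeds[OF tf len sub M]
    show ?thesis
      using emb by (auto simp: ind_le_iff_embeds rs cs Inl_Inr_eq_vertices_iff)
  next
    case False
    then have "\<forall>c\<in>set cs. isl c" using col hd by blast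
    moreover from this have "\<forall>r\<in>set rs. \<not> isl r" using col hd by blast
    ultimately obtain xs ys where rs: "rs = map Inr xs" and cs: "cs = map Inl ys"
      using all_isl_list no_isl_list by metis
    have len: "length xs = length M" "length ys = length (hd M)" using p rs cs by simp_all
    have sub: "set xs \<subseteq> rows (transpose_bg G)" "set ys \<subseteq> cols (transpose_bg G)"
      using p unfolding rs cs vertices_def by auto
    have M: "\<forall>i<length M. \<forall>j<length (hd M). (xs ! i, ys ! j) \<in> edges (transpose_bg G) \<longleftrightarrow> M ! i ! j = 1"
      using p len by (simp add: rs cs adj_def)
    note emb = mat_graph_embeds[OF tf len sub M]
    have "embeds (transpose_bg G) (mat_graph M) \<Longrightarrow> embeds G (transpose_bg (mat_graph M))"
      using embeds_transpose[of "transpose_bg G" "mat_graph M"] by simp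
    then show ?thesis
      using emb by (auto simp: ind_le_iff_embeds rs cs Inl_Inr_eq_vertices_iff)
  qed
  then show "ind_le (mat_graph M) G" "vertices G = set rs \<union> set cs \<Longrightarrow> ind_le G (mat_graph M)"
    by blast+
qed

section \<open>Finite checks for the listed matrices\<close>

lemma twin_free_mat_graph_iff:
  "twin_free (mat_graph M) \<longleftrightarrow>
    (\<forall>i<length M. \<forall>i'<length M. (\<forall>j<length (hd M). M ! i ! j = 1 \<longleftrightarrow> M ! i' ! j = 1) \<longrightarrow> i = i') \<and>
    (\<forall>j<length (hd M). \<forall>j'<length (hd M). (\<forall>i<length M. M ! i ! j = 1 \<longleftrightarrow> M ! i ! j' = 1) \<longrightarrow> j = j')"
  by (auto simp: twin_free_def Ball_def)

lemma forbidden_twin_free: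
  assumes "M \<in> forbidden_mats"
  shows "twin_free (mat_graph M)" "M \<noteq> []" "hd M \<noteq> []" "ereal (eta 6) < schur_norm F (mat_graph M)"
proof -
  show "twin_free (mat_graph M)"
    using assms by (elim insertE emptyE)
      (simp_all add: twin_free_mat_graph_iff All_less_Suc staircase3_mat_def band3_mat_def cycle6_mat_def
        spider2221_mat_def adjacent_deg3_mat_def spider322_mat_def distance2_deg3_mat_def
        spider421_mat_def path10_mat_def cycle10_mat_def)
  show "M \<noteq> []" "hd M \<noteq> []"
    using assms by (auto simp: staircase3_mat_def band3_mat_def cycle6_mat_def
        spider2221_mat_def adjacent_deg3_mat_def spider322_mat_def distance2_deg3_mat_def
        spider421_mat_def path10_mat_def cycle10_mat_def)
  show "ereal (eta 6) < schur_norm F (mat_graph M)"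
    using assms by (auto simp: schur_norm_staircase3 schur_norm_band3 schur_norm_cycle6
        schur_norm_spider2221 schur_norm_adjacent_deg3 schur_norm_spider322 schur_norm_distance2_deg3
        schur_norm_spider421 schur_norm_path10 schur_norm_cycle10)
qed

lemma mat_graph_ind_le:
  assumes "twin_free (mat_graph M)" "length xs = length M" "length ys = length (hd M)"
    "\<forall>i<length M. xs ! i < length N" "\<forall>j<length (hd M). ys ! j < length (hd N)"
    "\<forall>i<length M. \<forall>j<length (hd M). N ! (xs ! i) ! (ys ! j) = 1 \<longleftrightarrow> M ! i ! j = 1"
  shows "ind_le (mat_graph M) (mat_graph N)"
  unfolding ind_le_iff_embeds
  by (rule disjI1, rule mat_graph_embeds(1)[of M xs ys]) (use assms in \<open>auto simp: in_set_conv_nth\<close>)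

text \<open>The value of \<open>k\<close> is 1 for the edge, 2 for the paths on 4 and 5 vertices, 3
  for those on 6 and 7 vertices and the 8-cycle, 6 for those on 8 and 9 vertices, 5 for the spider
  with legs 2, 2, 2, and 4 for the other spiders.\<close>

lemma classified_sandwich:
  assumes "M \<in> path_mats \<union> spider_mats"
  shows "twin_free (mat_graph M) \<and> M \<noteq> [] \<and> hd M \<noteq> [] \<and>
    (\<exists>k\<in>{1..6}. ind_le (E_graph k) (mat_graph M) \<and> ind_le (mat_graph M) (F_graph k))"
    (is "?sandwich M")
proof -
  note simps = twin_free_mat_graph_iff All_less_Suc
  have *: "?sandwich M"
    if "k \<in> {1..6}" "twin_free (mat_graph M)" "M \<noteq> []" "hd M \<noteq> []"
      "ind_le (E_graph k) (mat_graph M)" "ind_le (mat_graph M) (F_graph k)" for M k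
    using that by blast
  have s1: "?sandwich [[1]]"
    by (rule *[of 1]; (unfold E_graph_def F_graph_def)?)
      (simp_all add: simps mat_graph_ind_le[where xs = "[0]" and ys = "[0]"]
        mat_graph_ind_le[where xs = "[0]" and ys = "[0]"])
  have s2: "?sandwich [[1,1],[0,1]]"
    by (rule *[of 2]; (unfold E_graph_def F_graph_def)?)
      (simp_all add: simps mat_graph_ind_le[where xs = "[0, 1]" and ys = "[0, 1]"]
        mat_graph_ind_le[where xs = "[0, 1]" and ys = "[0, 1]"])
  have s3: "?sandwich [[1,1,0],[0,1,1]]"
    by (rule *[of 2]; (unfold E_graph_def F_graph_def)?)
      (simp_all add: simps mat_graph_ind_le[where xs = "[0, 1]" and ys = "[0, 1]"]
        mat_graph_ind_le[where xs = "[0, 1]" and ys = "[0, 1, 2]"])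
  have s4: "?sandwich [[1,1,0],[0,1,1],[0,0,1]]"
    by (rule *[of 3]; (unfold E_graph_def F_graph_def)?)
      (simp_all add: simps mat_graph_ind_le[where xs = "[0, 1, 2]" and ys = "[0, 1, 2]"]
        mat_graph_ind_le[where xs = "[0, 2, 3]" and ys = "[0, 1, 3]"])
  \<comment> \<open>The path on seven vertices is the 8-cycle with one row removed, here row 1 of
    \<open>F_graph 3\<close>; removing also column 2 gives the path on six vertices.\<close>
  have s5: "?sandwich [[1,1,0,0],[0,1,1,0],[0,0,1,1]]"
    by (rule *[of 3]; (unfold E_graph_def F_graph_def)?)
      (simp_all add: simps mat_graph_ind_le[where xs = "[0, 1, 2]" and ys = "[0, 1, 2]"]
        mat_graph_ind_le[where xs = "[0, 2, 3]" and ys = "[0, 1, 3, 2]"])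
  have s6: "?sandwich [[1,1,0,0],[1,0,1,0],[0,1,0,1],[0,0,1,1]]"
    by (rule *[of 3]; (unfold E_graph_def F_graph_def)?)
      (simp_all add: simps mat_graph_ind_le[where xs = "[0, 2, 3]" and ys = "[0, 1, 3]"]
        mat_graph_ind_le[where xs = "[0, 1, 2, 3]" and ys = "[0, 1, 2, 3]"])
  have s7: "?sandwich [[1,1,0,0],[0,1,1,0],[0,0,1,1],[0,0,0,1]]"
    by (rule *[of 6]; (unfold E_graph_def F_graph_def)?)
      (simp_all add: simps mat_graph_ind_le[where xs = "[0, 1, 2, 3]" and ys = "[0, 1, 2, 3]"]
        mat_graph_ind_le[where xs = "[0, 1, 2, 3]" and ys = "[0, 1, 2, 3]"])
  have s8: "?sandwich [[1,1,0,0,0],[0,1,1,0,0],[0,0,1,1,0],[0,0,0,1,1]]"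
    by (rule *[of 6]; (unfold E_graph_def F_graph_def)?)
      (simp_all add: simps mat_graph_ind_le[where xs = "[0, 1, 2, 3]" and ys = "[0, 1, 2, 3]"]
        mat_graph_ind_le[where xs = "[0, 1, 2, 3]" and ys = "[0, 1, 2, 3, 4]"])
  have s9: "?sandwich [[1,0,0],[1,1,1],[0,0,1]]"
    by (rule *[of 4]; (unfold E_graph_def F_graph_def)?)
      (simp_all add: simps mat_graph_ind_le[where xs = "[0, 1, 2]" and ys = "[0, 1, 2]"]
        mat_graph_ind_le[where xs = "[0, 1, 2]" and ys = "[0, 1, 2]"])
  have s10: "?sandwich [[1,0,0,1],[1,1,1,0],[0,0,1,0]]"
    by (rule *[of 4]; (unfold E_graph_def F_graph_def)?)
      (simp_all add: simps mat_graph_ind_le[where xs = "[0, 1, 2]" and ys = "[0, 1, 2]"]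
        mat_graph_ind_le[where xs = "[0, 1, 2]" and ys = "[0, 1, 2, 3]"])
  have s11: "?sandwich [[1,0,0,1,0],[1,1,1,0,0],[0,0,1,0,1]]"
    by (rule *[of 4]; (unfold E_graph_def F_graph_def)?)
      (simp_all add: simps mat_graph_ind_le[where xs = "[0, 1, 2]" and ys = "[0, 1, 2]"]
        mat_graph_ind_le[where xs = "[0, 1, 2]" and ys = "[0, 1, 2, 3, 4]"])
  have s12: "?sandwich [[1,1,0,0],[1,0,1,0],[1,0,0,1]]"
    by (rule *[of 5]; (unfold E_graph_def F_graph_def)?)
      (simp_all add: simps mat_graph_ind_le[where xs = "[0, 1, 2]" and ys = "[0, 1, 2, 3]"]
        mat_graph_ind_le[where xs = "[0, 1, 2]" and ys = "[0, 1, 2, 3]"])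
  show ?thesis
    by (insert assms, elim UnE insertE emptyE; hypsubst; rule s1 s2 s3 s4 s5 s6 s7 s8 s9 s10 s11 s12)
qed

section \<open>Classification and the equivalence\<close>

theorem classification:
  assumes G: "bigraph G" "twin_free G" "connected_bg G" and norm: "schur_norm F G \<le> ereal (eta 6)"
  shows "\<exists>k\<in>{1..6}. ind_le (E_graph k) G \<and> ind_le G (F_graph k)"
proof -
  let ?A = "\<lambda>u v. (u, v) \<in> adj G"
  interpret bipartite ?A isl "vertices G" using bigraph_bipartite[OF G(1)] .
  interpret small_norm_graph ?A isl "vertices G"
  proof unfold_locales
    fix u v assume uv: "u \<in> vertices G" "v \<in> vertices G" "isl u = isl v" "\<And>w. ?A u w \<longleftrightarrow> ?A v w"
    show "u = v"
    proof (cases u; cases v)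
      fix r r' assume r: "u = Inl r" "v = Inl r'"
      have "(r, c) \<in> edges G \<longleftrightarrow> (r', c) \<in> edges G" for c
        using uv(4)[of "Inr c"] r by (simp add: adj_def)
      then show "u = v" using G(2) uv(1,2) r unfolding twin_free_def vertices_def by blast
    next
      fix c c' assume c: "u = Inr c" "v = Inr c'"
      have "(r, c) \<in> edges G \<longleftrightarrow> (r, c') \<in> edges G" for r
        using uv(4)[of "Inl r"] c by (simp add: adj_def)
      then show "u = v" using G(2) uv(1,2) c unfolding twin_free_def vertices_def by blast
    qed (use uv(3) in auto)
  next
    fix u S assume S: "u \<in> S" "S \<subseteq> vertices G" "\<And>x y. x \<in> S \<Longrightarrow> ?A x y \<Longrightarrow> y \<in> S"
    have "v \<in> S" if "v \<in> vertices G" for v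
    proof -
      have "(u, v) \<in> (adj G)\<^sup>*" using G(3) S(1,2) that unfolding connected_bg_def by blast
      then show ?thesis by (induction rule: rtrancl_induct) (use S in auto)
    qed
    then show "vertices G = S" using S(2) by blast
  next
    obtain r c where "r \<in> rows G" "c \<in> cols G" using G(1) unfolding bigraph_def by blast
    then have "(Inl r, Inr c) \<in> (adj G)\<^sup>*"
      using G(3) unfolding connected_bg_def vertices_def by blast
    \<comment> \<open>A row and a column are distinct vertices, so a walk connecting them has a
      first edge.\<close>
    then show "\<exists>u v. ?A u v" by (cases rule: converse_rtranclE) auto
  next
    fix M rs cs
    assume M: "M \<in> forbidden_mats"
    show "\<not> pattern M rs cs"
    proof
      assume pat: "pattern M rs cs"
      then have "rs \<noteq> []" "cs \<noteq> []" using forbidden_twin_free(2,3)[OF M] by (auto simp: pattern_def)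
      then have "ind_le (mat_graph M) G"
        using pattern_ind_le(1)[OF G(1) forbidden_twin_free(1)[OF M] pat] by blast
      \<comment> \<open>Monotonicity passes the norm bound to the induced subgraph, against its
        certified lower bound.\<close>
      then have "schur_norm F (mat_graph M) \<le> ereal (eta 6)"
        using schur_norm_mono norm order_trans by blast
      then show False using forbidden_twin_free(4)[OF M, of F] by simp
    qed
  qed
  obtain M rs cs where M: "M \<in> path_mats \<union> spider_mats"
    and pat: "pattern M rs cs" and V: "vertices G = set rs \<union> set cs"
  proof (cases "\<exists>v a b c. ?A v a \<and> ?A v b \<and> ?A v c \<and> distinct [a, b, c]")
    case True
    then show thesis using classify_deg3 that by blast
  next
    case False
    then show thesis using classify_deg2 that by blast
  qed
  obtain k where k: "k \<in> {1..6}" "ind_le (E_graph k) (mat_graph M)" "ind_le (mat_graph M) (F_graph k)"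
    and tf: "twin_free (mat_graph M)" and ne: "M \<noteq> []" "hd M \<noteq> []"
    using classified_sandwich[OF M] by blast
  have "rs \<noteq> []" "cs \<noteq> []" using pat ne by (auto simp: pattern_def)
  then have "ind_le (mat_graph M) G" "ind_le G (mat_graph M)"
    using pattern_ind_le[OF G(1) tf pat] V by blast+
  then show ?thesis using k ind_le_trans by blast
qed

lemma eta_strict_mono:
  assumes "i < j" "j \<le> 6"
  shows "eta i < eta j"
  using assms
proof (induction j)
  case (Suc j)
  then show ?case using eta_less_Suc[of j] by (cases "i = j") auto
qed simp

lemma schur_norm_sandwich:
  assumes "k \<in> {1..6}" "ind_le (E_graph k) G" "ind_le G (F_graph k)"
  shows "schur_norm F G = ereal (eta k)"
proof -
  have "k = 1 \<or> k = 2 \<or> k = 3 \<or> k = 4 \<or> k = 5 \<or> k = 6" using assms(1) by auto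
  then have "ereal (eta k) \<le> schur_norm F (E_graph k)" "schur_norm F (F_graph k) \<le> ereal (eta k)"
    using schur_norm_E1 schur_norm_E2 schur_norm_E3 schur_norm_E4 schur_norm_E5 schur_norm_E6
      schur_norm_F1 schur_norm_F2 schur_norm_F3 schur_norm_F4 schur_norm_F5 schur_norm_F6 by blast+
  then show ?thesis using schur_norm_mono[OF assms(2)] schur_norm_mono[OF assms(3)]
    by (meson antisym order_trans)
qed

theorem theorem6p7:
  fixes G :: bgraph and F :: scalar_field and k :: nat
  assumes "bigraph G" and "twin_free G" and "connected_bg G"
    and "k \<in> {1..6}"
  shows "(ind_le (E_graph k) G \<and> ind_le G (F_graph k) \<longleftrightarrow> schur_norm F G = ereal (eta k)) \<and>
         (schur_norm F G = ereal (eta k) \<longleftrightarrow>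
            ereal (eta (k - 1)) < schur_norm F G \<and> schur_norm F G \<le> ereal (eta k))"
proof -
  have up: "schur_norm F G = ereal (eta k)" if "ind_le (E_graph k) G \<and> ind_le G (F_graph k)"
    using schur_norm_sandwich assms(4) that by blast
  have gap: "eta (k - 1) < eta k" using assms(4) by (intro eta_strict_mono) auto
  have down: "ind_le (E_graph k) G \<and> ind_le G (F_graph k)"
    if n: "ereal (eta (k - 1)) < schur_norm F G" "schur_norm F G \<le> ereal (eta k)"
  proof -
    have "eta k \<le> eta 6" using eta_strict_mono[of k 6] assms(4) by (cases "k = 6") auto
    then have "schur_norm F G \<le> ereal (eta 6)" using n(2) by (meson ereal_less_eq(3) order_trans)
    \<comment> \<open>The classification yields some index \<open>j\<close> with norm exactly
      \<open>eta j\<close>; strict monotonicity of \<open>eta\<close> and the half-open interval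
      then force \<open>j = k\<close>.\<close>
    then obtain j where j: "j \<in> {1..6}" "ind_le (E_graph j) G" "ind_le G (F_graph j)"
      using classification[OF assms(1-3)] by blast
    then have e: "schur_norm F G = ereal (eta j)" by (rule schur_norm_sandwich)
    have "\<not> j < k"
    proof
      assume "j < k"
      then have "j < k - 1 \<or> j = k - 1" by linarith
      then have "eta j \<le> eta (k - 1)"
      proof
        assume "j < k - 1"
        moreover have "k - 1 \<le> 6" using assms(4) by auto
        ultimately show ?thesis by (rule less_imp_le[OF eta_strict_mono])
      qed simp
      then show False using n(1) e by simp
    qed
    moreover have "\<not> k < j" using eta_strict_mono[of k j] j(1) n(2) e by auto
    ultimately have "j = k" by simp
    then show ?thesis using j by blast
  qed
  have "ereal (eta (k - 1)) < schur_norm F G \<and> schur_norm F G \<le> ereal (eta k)"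
    if "schur_norm F G = ereal (eta k)"
    using gap that by simp
  then show ?thesis using up down by blast
qed

end
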